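(* Let $Q_0\subset\mathbb R^d$ be a cube, $0<q\le\infty$ and $b<-1/q$. Assume $w\in A_\infty(Q_0)$ and $f\in L_p(Q_0,w)$ for some $1<p<\infty$. Then $$\inf_{c\in\mathbb R}\bigg(\int_0^1(1-\log t)^{bq}\Big(\sup_{t<u<1}(1-\log u)^{-1}(f-c)^*_w(u)\Big)^q\frac{dt}t\bigg)^{1/q}\lesssim\|f^{\#}_{Q_0}\|_{L_{\infty,q}(\log L)_b(Q_0,w)}$$ (with the usual modification if $q=\infty$). In particular, $$\inf_{c\in\mathbb R}\|f-c\|_{L_{\infty,q}(\log L)_{b-1}(Q_0,w)}\lesssim\|f^{\#}_{Q_0}\|_{L_{\infty,q}(\log L)_b(Q_0,w)}$$ and $$\inf_{c\in\mathbb R}\|f-c\|_{\exp L^{\frac{\lambda}{\lambda+1}}(Q_0,w)}\lesssim\|f^{\#}_{Q_0}\|_{\exp L^\lambda(Q_0,w)},\qquad\lambda>0.$$ The corresponding result with $f^{\#}_{Q_0}$ replaced by $M^{\#}_{s,Q_0}f$, for $s$ small enough, also holds true. All implicit constants are independent of $f$.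
   Context: Cubes have sides parallel to the axes. A weight is a non-negative integrable function $w$ on $Q_0$, $w(E)=\int_Ew\,dx$, and $w\in A_\infty(Q_0)$ means there are $C_w,\delta>0$ with $\frac{w(E)}{w(Q)}\le C_w\big(\frac{|E|_d}{|Q|_d}\big)^\delta$ for all cubes $Q\subseteq Q_0$ and measurable $E\subseteq Q$. $f^*_w(t)=\inf\{\lambda\ge0:w\{x\in Q_0:|f(x)|>\lambda\}\le t\}$. With respect to Lebesgue measure, $f^{\#}_{Q_0}(x)=\sup_{x\in Q\subset Q_0}\frac1{|Q|_d}\int_Q|f-f_Q|$, $f_Q=\frac1{|Q|_d}\int_Qf$, and for $s\in(0,1)$, $M^{\#}_{s,Q_0}f(x)=\sup_{x\in Q\subset Q_0}\inf_{c\in\mathbb R}\inf\{\alpha\ge0:|\{y\in Q:|f(y)-c|>\alpha\}|_d<s|Q|_d\}$. The Lorentz--Zygmund quasi-norm is $\|g\|_{L_{\infty,q}(\log L)_b(Q_0,w)}=\big(\int_0^1((1+|\log t|)^bg^*_w(t))^q\frac{dt}t\big)^{1/q}$ ($\sup_{0<t<1}(1+|\log t|)^bg_w^*(t)$ if $q=\infty$). For $\lambda>0$, $\exp L^\lambda(Q_0,w)$ is the space $L_{\infty,\infty}(\log L)_{-1/\lambda}(Q_0,w)$. $A\lesssim B$ means $A\le CB$ with a constant $C>0$. *)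

theory Defs
  imports "HOL-Analysis.Analysis"
begin

text \<open>
  Quantities that may be infinite (maximal functions, rearrangements, quasi-norms) take values in
  \<^typ>\<open>ennreal\<close>, so that inequalities with an infinite right-hand side are meaningful.
\<close>

definition cube :: "'a::euclidean_space set \<Rightarrow> bool" where
  "cube Q \<longleftrightarrow> (\<exists>a l. l > 0 \<and> Q = cbox a (a + l *\<^sub>R One))"

definition weight_on :: "'a::euclidean_space set \<Rightarrow> ('a \<Rightarrow> real) \<Rightarrow> bool" where
  "weight_on Q0 w \<longleftrightarrow> integrable (lebesgue_on Q0) w \<and> (\<forall>x\<in>Q0. 0 \<le> w x)"

definition wmeasure :: "'a::euclidean_space set \<Rightarrow> ('a \<Rightarrow> real) \<Rightarrow> 'a measure" where
  "wmeasure Q0 w = density (lebesgue_on Q0) (\<lambda>x. ennreal (w x))"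

text \<open>
  A cube with \<open>w(Q) = 0\<close> makes the quotient on the left equal to \<open>0\<close>. For \<open>A\<^sub>\<infinity>\<close> weights this
  occurs only if \<open>w = 0\<close> almost everywhere on \<open>Q0\<close>.
\<close>

definition A_infinity :: "'a::euclidean_space set \<Rightarrow> ('a \<Rightarrow> real) \<Rightarrow> bool" where
  "A_infinity Q0 w \<longleftrightarrow> weight_on Q0 w \<and>
     (\<exists>C \<delta>. C > 0 \<and> \<delta> > 0 \<and>
       (\<forall>Q E. cube Q \<and> Q \<subseteq> Q0 \<and> E \<in> sets lebesgue \<and> E \<subseteq> Q \<longrightarrow>
          measure (wmeasure Q0 w) E / measure (wmeasure Q0 w) Q
            \<le> C * (measure lebesgue E / measure lebesgue Q) powr \<delta>))"

definition in_Lp :: "real \<Rightarrow> 'a measure \<Rightarrow> ('a \<Rightarrow> real) \<Rightarrow> bool" where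
  "in_Lp p M f \<longleftrightarrow> f \<in> borel_measurable M \<and> integrable M (\<lambda>x. \<bar>f x\<bar> powr p)"

text \<open>The function \<open>g\<close> below is the modulus of the function that is rearranged.\<close>

definition rearrangement :: "'a measure \<Rightarrow> ('a \<Rightarrow> ennreal) \<Rightarrow> real \<Rightarrow> ennreal" where
  "rearrangement M g t =
     (INF \<alpha>\<in>{\<alpha>::real. 0 \<le> \<alpha> \<and> emeasure M {x \<in> space M. g x > ennreal \<alpha>} \<le> ennreal t}. ennreal \<alpha>)"

definition set_average :: "('a::euclidean_space \<Rightarrow> real) \<Rightarrow> 'a set \<Rightarrow> real" where
  "set_average f Q = set_lebesgue_integral lebesgue Q f / measure lebesgue Q"

text \<open>
  If \<open>f\<close> is not integrable on \<open>Q\<close>, then \<open>f - c\<close> is not integrable on \<open>Q\<close> for any constant \<open>c\<close>,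
  so the oscillation over \<open>Q\<close> is \<open>\<infinity>\<close> regardless of the junk value of the average.
\<close>

definition sharp_maximal :: "'a::euclidean_space set \<Rightarrow> ('a \<Rightarrow> real) \<Rightarrow> 'a \<Rightarrow> ennreal" where
  "sharp_maximal Q0 f x =
     (SUP Q\<in>{Q. cube Q \<and> x \<in> Q \<and> Q \<subseteq> Q0}.
        (\<integral>\<^sup>+y\<in>Q. ennreal \<bar>f y - set_average f Q\<bar> \<partial>lebesgue) / emeasure lebesgue Q)"

definition local_sharp_maximal ::
    "real \<Rightarrow> 'a::euclidean_space set \<Rightarrow> ('a \<Rightarrow> real) \<Rightarrow> 'a \<Rightarrow> ennreal" where
  "local_sharp_maximal s Q0 f x =
     (SUP Q\<in>{Q. cube Q \<and> x \<in> Q \<and> Q \<subseteq> Q0}. INF c::real.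
        INF \<alpha>\<in>{\<alpha>::real. 0 \<le> \<alpha> \<and>
              emeasure lebesgue {y \<in> Q. \<bar>f y - c\<bar> > \<alpha>} < ennreal s * emeasure lebesgue Q}.
          ennreal \<alpha>)"

text \<open>Only used for exponents \<open>r > 0\<close>.\<close>

definition ennreal_power :: "ennreal \<Rightarrow> real \<Rightarrow> ennreal" where
  "ennreal_power x r = (if x = \<infinity> then \<infinity> else ennreal (enn2real x powr r))"

definition Lq_log :: "ennreal \<Rightarrow> (real \<Rightarrow> ennreal) \<Rightarrow> ennreal" where
  "Lq_log q h =
     (if q = \<infinity> then (SUP t\<in>{0<..<1}. h t)
      else ennreal_power
             (\<integral>\<^sup>+t\<in>{0<..<1}. (ennreal_power (h t) (enn2real q) * ennreal (1 / t)) \<partial>lborel)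
             (1 / enn2real q))"

definition LZ_norm :: "'a measure \<Rightarrow> ennreal \<Rightarrow> real \<Rightarrow> ('a \<Rightarrow> ennreal) \<Rightarrow> ennreal" where
  "LZ_norm M q b g = Lq_log q (\<lambda>t. ennreal ((1 + \<bar>ln t\<bar>) powr b) * rearrangement M g t)"

definition expL_norm :: "'a measure \<Rightarrow> real \<Rightarrow> ('a \<Rightarrow> ennreal) \<Rightarrow> ennreal" where
  "expL_norm M r g = LZ_norm M \<infinity> (- 1 / r) g"

definition LZ_sup_norm :: "'a measure \<Rightarrow> ennreal \<Rightarrow> real \<Rightarrow> ('a \<Rightarrow> ennreal) \<Rightarrow> ennreal" where
  "LZ_sup_norm M q b g =
     Lq_log q (\<lambda>t. ennreal ((1 - ln t) powr b) *
       (SUP u\<in>{t<..<1}. ennreal (1 / (1 - ln u)) * rearrangement M g u))"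

end

theory Submission
  imports Defs
begin

text \<open>
  For \<open>w \<in> A\<^sub>\<infinity>\<close> there are \<open>\<kappa> \<in> (0,1]\<close>, \<open>B\<close> and \<open>s\<^sub>0\<close> such that, for \<open>s \<le> s\<^sub>0\<close> and \<open>c\<close> a median of \<open>f\<close> on
  \<open>Q\<^sub>0\<close>, \<open>(f - c)\<^sup>*\<^sub>w(t) \<le> B (1 - log t) (M\<^sup>#\<^sub>s f)\<^sup>*\<^sub>w(\<kappa> t)\<close> for all \<open>0 < t < 1\<close>. Since rearrangements are
  monotone, this pointwise bound yields every norm inequality after the substitution \<open>t \<mapsto> \<kappa> t\<close>, which
  changes the logarithmic weight by a constant factor only.

  The pointwise bound is a John--Nirenberg argument relative to the exceptional set
  \<open>E = {M\<^sup>#\<^sub>s f > \<alpha>}\<close>: a cube not contained in \<open>E\<close> has oscillation at most \<open>\<alpha>\<close>, and stopping at the dyadic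
  subcubes on which \<open>{|f - c| > \<mu>}\<close> has density above \<open>2\<^sup>-\<^sup>d\<^sup>-\<^sup>1\<close> selects cubes of total \<open>w\<close>-measure
  at most half of that of the parent, whose centers \<open>c'\<close> satisfy \<open>|c - c'| \<le> 2\<mu>\<close>. Hence \<open>w({|f - c| > \<mu> + 2k\<mu>} - E)\<close> decays like
  \<open>2\<^sup>-\<^sup>k\<close>, and \<open>k\<close> of order \<open>1 - log t\<close> makes it at most \<open>t/2\<close>. Finally \<open>M\<^sup>#\<^sub>s f \<le> f\<^sup># / s\<close> by Chebyshev's inequality.
\<close>

section \<open>Dyadic stopping\<close>

text \<open>For \<open>l > 0\<close>, the half-open cube of generation \<open>n\<close> that
  contains \<open>x\<close>, in the grid of side \<open>l / 2 ^ n\<close> anchored at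
  \<open>a\<close>. Encoded as a fibre of the index map, a cell is an equivalence class, so cells of
  one generation tile the whole space and those that meet are equal.\<close>

definition dyadic_cell :: "'a::euclidean_space \<Rightarrow> real \<Rightarrow> nat \<Rightarrow> 'a \<Rightarrow> 'a set" where
  "dyadic_cell a l n x =
     {y. \<forall>i\<in>Basis. \<lfloor>2 ^ n * ((y - a) \<bullet> i) / l\<rfloor> = \<lfloor>2 ^ n * ((x - a) \<bullet> i) / l\<rfloor>}"

lemma dyadic_cell_self: "x \<in> dyadic_cell a l n x"
  by (simp add: dyadic_cell_def)

lemma dyadic_cell_eq: "y \<in> dyadic_cell a l n x \<Longrightarrow> dyadic_cell a l n y = dyadic_cell a l n x"
  by (simp add: dyadic_cell_def)

text \<open>The index of a cell determines that of its parent, by integer division by 2 in each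
  coordinate.\<close>

lemma dyadic_cell_Suc_subset: "dyadic_cell a l (Suc n) x \<subseteq> dyadic_cell a l n x"
proof -
  have half: "\<lfloor>2 ^ n * r / l\<rfloor> = \<lfloor>2 ^ Suc n * r / l\<rfloor> div 2" for r
    using floor_divide_real_eq_div[of 2 "2 ^ Suc n * r / l"] by simp
  show ?thesis
    unfolding dyadic_cell_def half by auto
qed

lemma dyadic_cell_antimono: "m \<le> n \<Longrightarrow> dyadic_cell a l n x \<subseteq> dyadic_cell a l m x"
  by (induction rule: dec_induct) (use dyadic_cell_Suc_subset in blast)+

definition dyadic_corner :: "'a::euclidean_space \<Rightarrow> real \<Rightarrow> nat \<Rightarrow> 'a \<Rightarrow> 'a" where
  "dyadic_corner a l n x = a + (\<Sum>i\<in>Basis. (l / 2 ^ n * \<lfloor>2 ^ n * ((x - a) \<bullet> i) / l\<rfloor>) *\<^sub>R i)"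

text \<open>For \<open>l > 0\<close>, the closure of the cell. Cells serve where disjointness
  matters, closed cubes where a hypothesis about cubes is applied; the two differ by a null
  set.\<close>

definition dyadic_cube :: "'a::euclidean_space \<Rightarrow> real \<Rightarrow> nat \<Rightarrow> 'a \<Rightarrow> 'a set" where
  "dyadic_cube a l n x =
     cbox (dyadic_corner a l n x) (dyadic_corner a l n x + (l / 2 ^ n) *\<^sub>R One)"

lemma dyadic_corner_inner:
  "i \<in> Basis \<Longrightarrow>
   dyadic_corner a l n x \<bullet> i = a \<bullet> i + l / 2 ^ n * \<lfloor>2 ^ n * ((x - a) \<bullet> i) / l\<rfloor>"
  by (simp add: dyadic_corner_def inner_add_left)

lemma dyadic_cell_iff:
  assumes "l > 0"
  shows "y \<in> dyadic_cell a l n x \<longleftrightarrow>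
    (\<forall>i\<in>Basis. dyadic_corner a l n x \<bullet> i \<le> y \<bullet> i \<and>
                y \<bullet> i < dyadic_corner a l n x \<bullet> i + l / 2 ^ n)"
proof -
  have "\<lfloor>2 ^ n * r / l\<rfloor> = k \<longleftrightarrow> l / 2 ^ n * k \<le> r \<and> r < l / 2 ^ n * k + l / 2 ^ n" for r k
    using assms unfolding floor_eq_iff by (auto simp: field_simps)
  then have "\<lfloor>2 ^ n * ((y - a) \<bullet> i) / l\<rfloor> = \<lfloor>2 ^ n * ((x - a) \<bullet> i) / l\<rfloor> \<longleftrightarrow>
      dyadic_corner a l n x \<bullet> i \<le> y \<bullet> i \<and> y \<bullet> i < dyadic_corner a l n x \<bullet> i + l / 2 ^ n"
    if "i \<in> Basis" for i
    unfolding dyadic_corner_inner[OF that] inner_diff_left by auto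
  then show ?thesis
    by (simp add: dyadic_cell_def)
qed

lemma dyadic_cell_subset_cube:
  assumes "l > 0"
  shows "dyadic_cell a l n x \<subseteq> dyadic_cube a l n x"
  using assms by (intro subsetI) (simp add: dyadic_cell_iff dyadic_cube_def mem_box inner_add_left less_imp_le)

lemma box_subset_dyadic_cell:
  assumes "l > 0"
  shows "box (dyadic_corner a l n x) (dyadic_corner a l n x + (l / 2 ^ n) *\<^sub>R One)
    \<subseteq> dyadic_cell a l n x"
  using assms by (intro subsetI) (simp add: dyadic_cell_iff mem_box inner_add_left less_imp_le)

lemma negligible_dyadic_cube_minus_cell:
  assumes "l > 0"
  shows "negligible (dyadic_cube a l n x - dyadic_cell a l n x)"
  unfolding dyadic_cube_def
  by (rule negligible_subset[OF negligible_frontier_interval Diff_mono])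
     (use box_subset_dyadic_cell[OF assms] in auto)

lemma cube_dyadic_cube: "l > 0 \<Longrightarrow> cube (dyadic_cube a l n x)"
  unfolding cube_def dyadic_cube_def by (intro exI conjI, rule divide_pos_pos) auto

lemma dyadic_cell_lmeasurable:
  assumes "l > 0"
  shows "dyadic_cell a l n x \<in> lmeasurable"
proof -
  have "dyadic_cell a l n x = dyadic_cube a l n x - (dyadic_cube a l n x - dyadic_cell a l n x)"
    using dyadic_cell_subset_cube[OF assms] by blast
  then show ?thesis
    using negligible_dyadic_cube_minus_cell[OF assms, of a n x]
    by (metis dyadic_cube_def fmeasurable.Diff lmeasurable_cbox negligible_imp_measurable)
qed

lemma measure_cube:
  assumes "l > 0"
  shows "measure lebesgue (cbox a (a + l *\<^sub>R One :: 'a::euclidean_space)) = l ^ DIM('a)"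
  using assms by (simp add: content_cbox_if box_eq_empty inner_add_left)

lemma measure_dyadic_cell:
  fixes a x :: "'a::euclidean_space"
  assumes "l > 0"
  shows "measure lebesgue (dyadic_cell a l n x) = (l / 2 ^ n) ^ DIM('a)"
proof -
  have "measure lebesgue (dyadic_cell a l n x) = measure lebesgue (dyadic_cube a l n x)"
    using negligible_dyadic_cube_minus_cell[OF assms, of a n x] dyadic_cell_subset_cube[OF assms, of a n x]
    by (intro measure_negligible_symdiff dyadic_cell_lmeasurable assms)
       (auto simp: Un_absorb1 Diff_eq_empty_iff[THEN iffD2] sup_commute dyadic_cube_def)
  then show ?thesis
    using measure_cube[of "l / 2 ^ n"] assms by (simp add: dyadic_cube_def)
qed

lemma dyadic_cube_subset:
  assumes "l > 0" "x \<in> dyadic_cell a l 0 a"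
  shows "dyadic_cube a l n x \<subseteq> cbox a (a + l *\<^sub>R One)"
proof -
  have "0 \<le> \<lfloor>2 ^ n * ((x - a) \<bullet> i) / l\<rfloor> \<and> \<lfloor>2 ^ n * ((x - a) \<bullet> i) / l\<rfloor> + 1 \<le> 2 ^ n"
    if "i \<in> Basis" for i
  proof -
    define r where "r = (x - a) \<bullet> i / l"
    have "\<lfloor>r\<rfloor> = 0"
      using assms(2) that by (simp add: dyadic_cell_def r_def)
    then have "0 \<le> r" "r < 1"
      by linarith+
    then have "0 \<le> 2 ^ n * r" "2 ^ n * r < (2::real) ^ n"
      by simp_all
    \<comment> \<open>Strict inequality between integers provides the \<open>+ 1\<close> that keeps
      the upper corner inside.\<close>
    then have "0 \<le> \<lfloor>2 ^ n * r\<rfloor>" "\<lfloor>2 ^ n * r\<rfloor> < 2 ^ n"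
      by (simp_all add: floor_less_iff)
    then show ?thesis
      by (simp add: r_def)
  qed
  then have *: "0 \<le> real_of_int \<lfloor>2 ^ n * ((x - a) \<bullet> i) / l\<rfloor>"
      "real_of_int \<lfloor>2 ^ n * ((x - a) \<bullet> i) / l\<rfloor> + 1 \<le> 2 ^ n" if "i \<in> Basis" for i
    using that by (metis (mono_tags) of_int_1 of_int_add of_int_le_iff of_int_numeral of_int_power of_int_0)+
  have "a \<bullet> i \<le> dyadic_corner a l n x \<bullet> i \<and> dyadic_corner a l n x \<bullet> i + l / 2 ^ n \<le> a \<bullet> i + l"
    if "i \<in> Basis" for i
  proof -
    define k where "k = real_of_int \<lfloor>2 ^ n * ((x - a) \<bullet> i) / l\<rfloor>"
    have "0 \<le> l / 2 ^ n * k" "l / 2 ^ n * (k + 1) \<le> l / 2 ^ n * 2 ^ n"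
      using *[OF that] assms(1) unfolding k_def
      by (intro mult_nonneg_nonneg mult_left_mono; simp)+
    then show ?thesis
      by (simp add: dyadic_corner_inner that k_def distrib_left)
  qed
  then show ?thesis
    unfolding dyadic_cube_def by (intro subset_box_imp) (simp add: inner_add_left)
qed

lemma negligible_cbox_minus_dyadic_cell_0:
  "l > 0 \<Longrightarrow> negligible (cbox a (a + l *\<^sub>R One) - dyadic_cell a l 0 a)"
proof -
  assume l: "l > 0"
  have "dyadic_corner a l 0 a = a"
    by (simp add: dyadic_corner_def)
  then show ?thesis
    using negligible_dyadic_cube_minus_cell[OF l, of a 0 a] by (simp add: dyadic_cube_def)
qed

text \<open>Each point stops at the first generation \<open>N x\<close> at which \<open>P\<close>
  holds. Since \<open>P n\<close> is constant on cells of generation \<open>n\<close>, and hence on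
  smaller cells, all points of a stopped cell share the same stopping generation; two stopped cells
  that meet therefore coincide. Countability follows because cells have nonempty interior.\<close>

lemma dyadic_stopping:
  fixes a :: "'a::euclidean_space"
  assumes l: "l > 0" and P: "\<forall>n x. P n x \<longrightarrow> (\<forall>y\<in>dyadic_cell a l n x. P n y)"
  shows "\<exists>\<D>. countable \<D> \<and> disjoint \<D> \<and> \<Union>\<D> = {x. \<exists>n. P n x} \<and>
    (\<forall>D\<in>\<D>. \<exists>n x. D = dyadic_cell a l n x \<and> P n x \<and> (\<forall>m<n. \<not> P m x))"
proof -
  define N where "N x = (LEAST n. P n x)" for x
  define S where "S = {x. \<exists>n. P n x}"
  define \<D> where "\<D> = (\<lambda>x. dyadic_cell a l (N x) x) ` S"
  have P_iff: "P m y \<longleftrightarrow> P m x" if "y \<in> dyadic_cell a l n x" "m \<le> n" for m n x y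
  proof -
    have "y \<in> dyadic_cell a l m x" "x \<in> dyadic_cell a l m y"
      using dyadic_cell_antimono[OF that(2)] that(1) dyadic_cell_eq dyadic_cell_self by fast+
    then show ?thesis
      using P by blast
  qed
  have PN: "P (N x) x" "\<And>m. m < N x \<Longrightarrow> \<not> P m x" if "x \<in> S" for x
    using that unfolding N_def S_def by (auto intro: LeastI_ex dest: not_less_Least)
  have N_eq: "y \<in> S" "N y = N x" if "x \<in> S" "y \<in> dyadic_cell a l (N x) x" for x y
  proof -
    show "y \<in> S"
      using PN[OF that(1)] P_iff[OF that(2)] unfolding S_def by blast
    show "N y = N x"
      using PN[OF that(1)] P_iff[OF that(2)] PN[OF \<open>y \<in> S\<close>]
      by (metis linorder_less_linear order_refl less_imp_le)
  qed
  have disj: "disjoint \<D>"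
  proof (rule disjointI)
    fix A B assume "A \<in> \<D>" "B \<in> \<D>" "A \<noteq> B"
    then obtain x y where xy: "x \<in> S" "y \<in> S" "A = dyadic_cell a l (N x) x" "B = dyadic_cell a l (N y) y"
      by (auto simp: \<D>_def)
    show "A \<inter> B = {}"
    proof (rule ccontr)
      assume "A \<inter> B \<noteq> {}"
      then obtain z where z: "z \<in> dyadic_cell a l (N x) x" "z \<in> dyadic_cell a l (N y) y"
        using xy by blast
      then have "N x = N y"
        using N_eq(2)[OF xy(1)] N_eq(2)[OF xy(2)] by metis
      then have "A = B"
        using z[THEN dyadic_cell_eq] xy by metis
      with \<open>A \<noteq> B\<close> show False ..
    qed
  qed
  have "countable \<D>"
  proof (rule countable_disjoint_nonempty_interior_subsets)
    show "pairwise disjnt \<D>"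
      using disj by (auto simp: disjoint_def pairwise_def disjnt_def)
    fix D assume "D \<in> \<D>" "interior D = {}"
    then obtain n x where D: "D = dyadic_cell a l n x"
      by (auto simp: \<D>_def)
    have "box (dyadic_corner a l n x) (dyadic_corner a l n x + (l / 2 ^ n) *\<^sub>R One) \<subseteq> interior D"
      unfolding D by (intro interior_maximal box_subset_dyadic_cell l open_box)
    moreover have "box (dyadic_corner a l n x) (dyadic_corner a l n x + (l / 2 ^ n) *\<^sub>R One) \<noteq> {}"
      using l by (auto simp: box_eq_empty inner_add_left not_le)
    ultimately show "D = {}"
      using \<open>interior D = {}\<close> by blast
  qed
  moreover have "\<Union>\<D> = S"
    by (auto simp: \<D>_def intro: N_eq(1) dyadic_cell_self)
  moreover have "\<exists>n x. D = dyadic_cell a l n x \<and> P n x \<and> (\<forall>m<n. \<not> P m x)" if D: "D \<in> \<D>" for D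
  proof -
    obtain x where "x \<in> S" "D = dyadic_cell a l (N x) x"
      using D by (auto simp: \<D>_def)
    then show ?thesis
      using PN by metis
  qed
  ultimately show ?thesis
    using disj unfolding S_def by (intro exI[of _ \<D>] conjI ballI) simp_all
qed

lemma emeasure_countable_disjoint_le:
  assumes "countable \<D>" "disjoint \<D>"
    and A: "\<And>D. D \<in> \<D> \<Longrightarrow> A \<inter> D \<in> sets M" and B: "\<And>D. D \<in> \<D> \<Longrightarrow> B \<inter> D \<in> sets N"
    and le: "\<And>D. D \<in> \<D> \<Longrightarrow> emeasure M (A \<inter> D) \<le> c * emeasure N (B \<inter> D)"
  shows "emeasure M (A \<inter> \<Union>\<D>) \<le> c * emeasure N (B \<inter> \<Union>\<D>)"
proof -
  have disj: "disjoint_family_on (\<lambda>D. X \<inter> D) \<D>" for X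
    using assms(2) by (auto simp: disjoint_family_on_def disjoint_def)
  \<comment> \<open>The sum over the countable family is an integral against counting measure, so no
    enumeration of \<open>\<D>\<close> is chosen.\<close>
  have "emeasure M (A \<inter> \<Union>\<D>) = (\<integral>\<^sup>+D. emeasure M (A \<inter> D) \<partial>count_space \<D>)"
    unfolding Int_Union using emeasure_UN_countable[OF _ assms(1) disj] A by metis
  also have "\<dots> \<le> (\<integral>\<^sup>+D. c * emeasure N (B \<inter> D) \<partial>count_space \<D>)"
    by (intro nn_integral_mono) (simp add: le)
  also have "\<dots> = c * (\<integral>\<^sup>+D. emeasure N (B \<inter> D) \<partial>count_space \<D>)"
    by (rule nn_integral_cmult) simp
  also have "(\<integral>\<^sup>+D. emeasure N (B \<inter> D) \<partial>count_space \<D>) = emeasure N (B \<inter> \<Union>\<D>)"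
    unfolding Int_Union using emeasure_UN_countable[OF _ assms(1) disj] B by metis
  finally show ?thesis .
qed

section \<open>Dyadic density and the Calderon--Zygmund decomposition\<close>

lemma dyadic_cell_small:
  assumes "l > 0" "e > 0"
  obtains n where "dyadic_cell a l n x \<subseteq> ball x e"
proof -
  obtain n where n: "DIM('a) * l / e < 2 ^ n"
    using real_arch_pow[of 2] by auto
  have "dist x y < e" if "y \<in> dyadic_cell a l n x" for y :: 'a
  proof -
    have "\<bar>(x - y) \<bullet> i\<bar> \<le> l / 2 ^ n" if "i \<in> Basis" for i
      using that \<open>y \<in> _\<close>[unfolded dyadic_cell_iff[OF assms(1)]]
        dyadic_cell_self[of x a l n, unfolded dyadic_cell_iff[OF assms(1)]]
      by (force simp: inner_diff_left abs_if)
    then have "(\<Sum>i\<in>Basis. \<bar>(x - y) \<bullet> i\<bar>) \<le> (\<Sum>i\<in>(Basis::'a set). l / 2 ^ n)"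
      by (intro sum_mono) auto
    then have "dist x y \<le> DIM('a) * (l / 2 ^ n)"
      using norm_le_l1[of "x - y"] by (simp add: dist_norm)
    also have "\<dots> < e"
      using n assms by (simp add: field_simps)
    finally show ?thesis .
  qed
  then show ?thesis
    using that[of n] by (auto simp: subset_iff)
qed

lemma lmeasurable_Int_cell:
  "l > 0 \<Longrightarrow> F \<in> sets lebesgue \<Longrightarrow> F \<inter> dyadic_cell a l n x \<in> lmeasurable"
  using dyadic_cell_lmeasurable fmeasurable_Int_fmeasurable Int_commute by metis

text \<open>A dyadic form of the Lebesgue density theorem. Cover \<open>N\<close> by maximal cells
  that meet \<open>N\<close> and lie in an open \<open>U\<close> of measure below
  \<open>|N| + e\<close>. In each of them \<open>F\<close>, hence \<open>N\<close>, fills at most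
  the proportion \<open>\<theta>\<close>, so \<open>|N| \<le> \<theta> (|N| + e)\<close>; letting
  \<open>e\<close> tend to 0 forces \<open>|N| = 0\<close>.\<close>

lemma negligible_dyadic_density:
  fixes F :: "'a::euclidean_space set"
  assumes l: "l > 0" and F: "F \<in> sets lebesgue" and N: "N \<in> lmeasurable" "N \<subseteq> F"
    and \<theta>: "0 \<le> \<theta>" "\<theta> < 1"
    and sparse: "\<And>x n. x \<in> N \<Longrightarrow>
      measure lebesgue (F \<inter> dyadic_cell a l n x) \<le> \<theta> * measure lebesgue (dyadic_cell a l n x)"
  shows "negligible N"
proof -
  have "measure lebesgue N \<le> \<theta> * measure lebesgue N + e" if e: "e > 0" for e
  proof -
    obtain U where U: "open U" "N \<subseteq> U" "U \<in> lmeasurable" "measure lebesgue U < measure lebesgue N + e"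
    proof -
      obtain U where U: "open U" "N \<subseteq> U" "U - N \<in> lmeasurable" "emeasure lebesgue (U - N) < ennreal e"
        using sets_lebesgue_outer_open[of N e] N(1) e by blast
      have "measure lebesgue (U - N) < e"
        using U(3,4) e by (simp add: emeasure_eq_measure2 ennreal_less_iff)
      moreover have UL: "U \<in> lmeasurable"
        using fmeasurable_Diff_D[OF U(3) N(1) U(2)] .
      moreover have "measure lebesgue (U - N) = measure lebesgue U - measure lebesgue N"
        by (rule measurable_measure_Diff[OF UL fmeasurableD[OF N(1)] U(2)])
      ultimately show ?thesis
        using that U(1,2) by simp
    qed
    \<comment> \<open>A cell that meets \<open>N\<close> is also the cell of a point of
      \<open>N\<close>, and \<open>sparse\<close> speaks only of such cells.\<close>
    define P where "P n x \<longleftrightarrow> dyadic_cell a l n x \<subseteq> U \<and> dyadic_cell a l n x \<inter> N \<noteq> {}" for n x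
    have "P n y" if "y \<in> dyadic_cell a l n x" "P n x" for n x y
      using that dyadic_cell_eq unfolding P_def by metis
    then have "\<forall>n x. P n x \<longrightarrow> (\<forall>y\<in>dyadic_cell a l n x. P n y)"
      by blast
    from dyadic_stopping[OF l this] obtain \<D> where
      \<D>: "countable \<D>" "disjoint \<D>" "\<Union>\<D> = {x. \<exists>n. P n x}"
      "\<forall>D\<in>\<D>. \<exists>n x. D = dyadic_cell a l n x \<and> P n x \<and> (\<forall>m<n. \<not> P m x)"
      by (elim exE conjE)
    have cell: "\<exists>n z. z \<in> N \<and> D = dyadic_cell a l n z \<and> D \<subseteq> U" if D: "D \<in> \<D>" for D
    proof -
      obtain n x z where "D = dyadic_cell a l n x" "D \<subseteq> U" "z \<in> D" "z \<in> N"
        using bspec[OF \<D>(4) D] unfolding P_def by blast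
      then show ?thesis
        using dyadic_cell_eq by metis
    qed
    have "x \<in> \<Union>\<D>" if x: "x \<in> N" for x
    proof -
      obtain e where e: "e > 0" "ball x e \<subseteq> U"
        by (rule openE[OF U(1) subsetD[OF U(2) x]])
      obtain n where "dyadic_cell a l n x \<subseteq> ball x e"
        by (rule dyadic_cell_small[OF l e(1)])
      then have "P n x"
        using x e(2) dyadic_cell_self[of x a l n] unfolding P_def by auto
      then show ?thesis
        unfolding \<D>(3) by (intro CollectI exI)
    qed
    moreover have "\<D> \<subseteq> sets lebesgue"
      using cell dyadic_cell_lmeasurable[OF l] by blast
    ultimately have sub: "N \<subseteq> F \<inter> \<Union>\<D>" and sets: "\<Union>\<D> \<in> sets lebesgue"
      using N(2) \<D>(1) by (auto intro: sets.countable_Union)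
    have "\<Union>\<D> \<subseteq> U"
      using cell by blast
    have "ennreal (measure lebesgue N) = emeasure lebesgue N"
      using N(1) by (simp add: emeasure_eq_measure2)
    also have "\<dots> \<le> emeasure lebesgue (F \<inter> \<Union>\<D>)"
      by (rule emeasure_mono) (use sub F sets in auto)
    also have "\<dots> \<le> ennreal \<theta> * emeasure lebesgue (UNIV \<inter> \<Union>\<D>)"
    proof (rule emeasure_countable_disjoint_le[OF \<D>(1,2)])
      fix D assume "D \<in> \<D>"
      then obtain n z where z: "z \<in> N" "D = dyadic_cell a l n z"
        using cell by blast
      show "F \<inter> D \<in> sets lebesgue" "UNIV \<inter> D \<in> sets lebesgue"
        using F fmeasurableD[OF dyadic_cell_lmeasurable[OF l, of a n z]] unfolding z(2) by auto
      show "emeasure lebesgue (F \<inter> D) \<le> ennreal \<theta> * emeasure lebesgue (UNIV \<inter> D)"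
        using sparse[OF z(1), of n] lmeasurable_Int_cell[OF l F, of a n z]
          dyadic_cell_lmeasurable[OF l, of a n z] z(2) \<theta>(1)
        by (simp add: emeasure_eq_measure2 flip: ennreal_mult)
    qed
    also have "\<dots> \<le> ennreal \<theta> * emeasure lebesgue U"
      by (intro mult_left_mono emeasure_mono) (use \<open>\<Union>\<D> \<subseteq> U\<close> U in auto)
    also have "\<dots> = ennreal (\<theta> * measure lebesgue U)"
      using U(3) \<theta>(1) by (simp add: emeasure_eq_measure2 ennreal_mult)
    finally have "measure lebesgue N \<le> \<theta> * measure lebesgue U"
      using \<theta>(1) by (simp add: ennreal_le_iff)
    also have "\<dots> \<le> \<theta> * (measure lebesgue N + e)"
      using U(4) \<theta>(1) by (intro mult_left_mono) auto
    also have "\<dots> \<le> \<theta> * measure lebesgue N + e"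
      using \<theta> e by (simp add: distrib_left mult_left_le_one_le)
    finally show ?thesis .
  qed
  then have "measure lebesgue N \<le> \<theta> * measure lebesgue N"
    by (rule field_le_epsilon)
  then have "(1 - \<theta>) * measure lebesgue N \<le> 0"
    by (simp add: algebra_simps)
  then have "measure lebesgue N = 0"
    using \<theta>(2) measure_nonneg[of lebesgue N] by (simp add: mult_le_0_iff)
  then show ?thesis
    using N(1) by (simp add: negligible_iff_measure)
qed

text \<open>Stop at the first dyadic cell in which \<open>F\<close> has density above
  \<open>\<theta>\<close>. The parent of a stopped cell still has density at most
  \<open>\<theta>\<close> and is \<open>2 ^ DIM('a)\<close> times larger, which gives the upper
  bound. Points of \<open>F\<close> that never stop have all dyadic densities at most
  \<open>\<theta>\<close>, so they form a null set.\<close>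

lemma calderon_zygmund:
  fixes F :: "'a::euclidean_space set"
  assumes "cube Q" and F: "F \<in> sets lebesgue" "F \<subseteq> Q" and \<theta>: "0 < \<theta>" "\<theta> < 1"
    and small: "measure lebesgue F \<le> \<theta> * measure lebesgue Q"
  shows "\<exists>\<D>. countable \<D> \<and> disjoint \<D> \<and> negligible (F - \<Union>\<D>) \<and>
    (\<forall>D\<in>\<D>. D \<in> lmeasurable \<and> (\<exists>K. cube K \<and> D \<subseteq> K \<and> K \<subseteq> Q \<and> negligible (K - D)) \<and>
      \<theta> * measure lebesgue D < measure lebesgue (F \<inter> D) \<and>
      measure lebesgue (F \<inter> D) \<le> \<theta> * 2 ^ DIM('a) * measure lebesgue D)"
proof -
  obtain a l where l: "l > 0" and Q: "Q = cbox a (a + l *\<^sub>R One)"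
    using \<open>cube Q\<close> unfolding cube_def by blast
  \<comment> \<open>The grid covers the whole space; the first conjunct keeps only the cells inside
    \<open>Q\<close>.\<close>
  define P where "P n x \<longleftrightarrow> x \<in> dyadic_cell a l 0 a \<and>
    \<theta> * measure lebesgue (dyadic_cell a l n x) < measure lebesgue (F \<inter> dyadic_cell a l n x)" for n x
  have "P n y" if "y \<in> dyadic_cell a l n x" "P n x" for n x y
  proof -
    have "dyadic_cell a l 0 x = dyadic_cell a l 0 a"
      using that(2) dyadic_cell_eq unfolding P_def by blast
    then have "y \<in> dyadic_cell a l 0 a"
      using that(1) dyadic_cell_antimono[of 0 n a l x] by blast
    then show ?thesis
      using that dyadic_cell_eq unfolding P_def by metis
  qed
  then have "\<forall>n x. P n x \<longrightarrow> (\<forall>y\<in>dyadic_cell a l n x. P n y)"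
    by blast
  from dyadic_stopping[OF l this] obtain \<D> where
    \<D>: "countable \<D>" "disjoint \<D>" "\<Union>\<D> = {x. \<exists>n. P n x}"
    "\<forall>D\<in>\<D>. \<exists>n x. D = dyadic_cell a l n x \<and> P n x \<and> (\<forall>m<n. \<not> P m x)"
    by (elim exE conjE)
  have meas: "D \<in> lmeasurable" if D: "D \<in> \<D>" for D
    using bspec[OF \<D>(4) D] dyadic_cell_lmeasurable[OF l] by metis
  then have U: "\<Union>\<D> \<in> sets lebesgue"
    using \<D>(1) by (intro sets.countable_Union) auto
  have "F \<inter> dyadic_cell a l 0 a - \<Union>\<D> \<in> lmeasurable"
    using U lmeasurable_Int_cell[OF l F(1), of a 0 a] by (simp add: fmeasurable_Diff)
  then have "negligible (F \<inter> dyadic_cell a l 0 a - \<Union>\<D>)"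
    by (rule negligible_dyadic_density[OF l F(1), where \<theta> = \<theta>]) (use \<theta> in \<open>auto simp: \<D>(3) P_def not_less\<close>)
  \<comment> \<open>The half-open base cell misses some faces of the closed cube \<open>Q\<close>;
    they are null.\<close>
  moreover have "F - \<Union>\<D> \<subseteq> (F \<inter> dyadic_cell a l 0 a - \<Union>\<D>) \<union> (Q - dyadic_cell a l 0 a)"
    using F(2) by blast
  ultimately have "negligible (F - \<Union>\<D>)"
    using negligible_cbox_minus_dyadic_cell_0[OF l, of a] unfolding Q
    by (meson negligible_Un negligible_subset)
  moreover have "\<exists>K. cube K \<and> D \<subseteq> K \<and> K \<subseteq> Q \<and> negligible (K - D)" if D: "D \<in> \<D>" for D
  proof -
    obtain n x where "D = dyadic_cell a l n x" "x \<in> dyadic_cell a l 0 a"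
      using bspec[OF \<D>(4) D] unfolding P_def by blast
    then show ?thesis
      using l by (intro exI[of _ "dyadic_cube a l n x"])
        (simp add: Q cube_dyadic_cube dyadic_cell_subset_cube dyadic_cube_subset negligible_dyadic_cube_minus_cell)
  qed
  moreover have "\<theta> * measure lebesgue D < measure lebesgue (F \<inter> D)" if D: "D \<in> \<D>" for D
    using bspec[OF \<D>(4) D] unfolding P_def by blast
  moreover have "measure lebesgue (F \<inter> D) \<le> \<theta> * 2 ^ DIM('a) * measure lebesgue D" if D: "D \<in> \<D>" for D
  proof -
    obtain n x where nx: "D = dyadic_cell a l n x" "P n x" "\<forall>m<n. \<not> P m x"
      using bspec[OF \<D>(4) D] by blast
    have x: "x \<in> dyadic_cell a l 0 a"
      using nx(2) P_def by blast
    \<comment> \<open>Stopping at generation 0 would contradict \<open>small\<close>, so a stopped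
      cell has a parent inside the base cell that did not stop.\<close>
    have "n \<noteq> 0"
    proof
      assume "n = 0"
      then have "\<theta> * measure lebesgue Q < measure lebesgue (F \<inter> dyadic_cell a l 0 x)"
        using nx(2) measure_cube[OF l, of a] measure_dyadic_cell[OF l, of a 0 x] by (simp add: P_def Q)
      also have "\<dots> \<le> measure lebesgue F"
        by (rule measure_mono_fmeasurable)
           (use F lmeasurable_Int_cell[OF l F(1), of a 0 x] Q in
             \<open>auto intro: fmeasurableI2[OF lmeasurable_cbox]\<close>)
      finally show False
        using small by simp
    qed
    then obtain m where n: "n = Suc m"
      using not0_implies_Suc by blast
    have "measure lebesgue (F \<inter> D) \<le> measure lebesgue (F \<inter> dyadic_cell a l m x)"
      unfolding nx(1) n using dyadic_cell_Suc_subset[of a l m x]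
      by (intro measure_mono_fmeasurable lmeasurable_Int_cell l F(1) fmeasurableD) auto
    also have "\<dots> \<le> \<theta> * measure lebesgue (dyadic_cell a l m x)"
      using nx(3) x n by (auto simp: P_def not_less)
    also have "\<dots> = \<theta> * 2 ^ DIM('a) * measure lebesgue D"
      by (simp add: nx(1) n measure_dyadic_cell[OF l] power_divide power_mult_distrib)
    finally show ?thesis .
  qed
  ultimately show ?thesis
    using \<D>(1,2) meas by (intro exI[of _ \<D>] conjI ballI) simp_all
qed

section \<open>Exponential decay outside the exceptional set\<close>

lemma cube_lmeasurable: "cube Q \<Longrightarrow> Q \<in> lmeasurable"
  by (auto simp: cube_def)

lemma measure_cube_pos: "cube Q \<Longrightarrow> 0 < measure lebesgue Q"
  unfolding cube_def using measure_cube by (metis zero_less_power)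

text \<open>Induction on \<open>k\<close>, over all cubes and centers at once. Almost all of the
  level set of order \<open>Suc k\<close> lies in the cells selected for
  \<open>F = {|f - c| > \<mu>}\<close>. Cells inside \<open>E\<close> contribute nothing; on any
  other cell the induction hypothesis applies with a new center \<open>c'\<close>, at the cost of
  \<open>2 * \<mu>\<close> in the level, and gives the factor \<open>(1/2) ^ k\<close>. The
  remaining factor 1/2 comes from \<open>halving\<close>, applied to the union of the selected
  cells.\<close>

lemma good_lambda_iteration:
  fixes f :: "'a::euclidean_space \<Rightarrow> real" and \<nu> :: "'a measure"
  assumes sets: "\<And>A. A \<subseteq> Q0 \<Longrightarrow> A \<in> sets lebesgue \<Longrightarrow> A \<in> sets \<nu>"
    and null: "\<And>A. A \<subseteq> Q0 \<Longrightarrow> negligible A \<Longrightarrow> emeasure \<nu> A = 0"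
    and halving: "\<And>Q A. cube Q \<Longrightarrow> Q \<subseteq> Q0 \<Longrightarrow> A \<in> sets lebesgue \<Longrightarrow> A \<subseteq> Q \<Longrightarrow>
      \<theta> * measure lebesgue A \<le> s * measure lebesgue Q \<Longrightarrow> emeasure \<nu> A \<le> ennreal (1/2) * emeasure \<nu> Q"
    and \<theta>: "0 < \<theta>" "\<theta> * 2 ^ DIM('a) \<le> 1/2" and s: "s \<le> 1/2" "s \<le> \<theta>"
    and f: "\<And>Q c \<alpha>. cube Q \<Longrightarrow> Q \<subseteq> Q0 \<Longrightarrow> {y\<in>Q. \<bar>f y - c\<bar> > \<alpha>} \<in> sets lebesgue"
    and E: "E \<in> sets lebesgue"
    and osc: "\<And>Q. cube Q \<Longrightarrow> Q \<subseteq> Q0 \<Longrightarrow> \<not> Q \<subseteq> E \<Longrightarrow>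
      \<exists>c. measure lebesgue {y\<in>Q. \<bar>f y - c\<bar> > \<mu>} < s * measure lebesgue Q"
    and Q: "cube Q" "Q \<subseteq> Q0"
    and c: "measure lebesgue {y\<in>Q. \<bar>f y - c\<bar> > \<mu>} < s * measure lebesgue Q"
  shows "emeasure \<nu> {y\<in>Q - E. \<bar>f y - c\<bar> > \<mu> + 2 * \<mu> * real k} \<le> ennreal ((1/2) ^ k) * emeasure \<nu> Q"
  using Q c
proof (induction k arbitrary: Q c)
  case 0
  show ?case
    using sets[OF 0(2)] cube_lmeasurable[OF 0(1)] by (auto intro!: emeasure_mono)
next
  case (Suc k)
  define F where "F = {y\<in>Q. \<bar>f y - c\<bar> > \<mu>}"
  have F: "F \<in> sets lebesgue" "F \<subseteq> Q"
    using f[OF Suc.prems(1,2)] by (auto simp: F_def)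
  have Qm: "Q \<in> lmeasurable"
    by (rule cube_lmeasurable) fact
  have Fm: "F \<in> lmeasurable"
    using F Qm fmeasurableI2 by blast
  have F_small: "measure lebesgue F < s * measure lebesgue Q"
    using Suc.prems(3) by (simp add: F_def)
  also have "\<dots> \<le> \<theta> * measure lebesgue Q"
    using s by (intro mult_right_mono) auto
  finally have small: "measure lebesgue F \<le> \<theta> * measure lebesgue Q"
    by simp
  have "2 \<le> (2::real) ^ DIM('a)"
    using power_increasing[of 1 "DIM('a)" "2::real"] DIM_positive[where 'a = 'a] by simp
  then have "\<theta> * 2 \<le> \<theta> * 2 ^ DIM('a)"
    using \<theta>(1) by (intro mult_left_mono) auto
  then have \<theta>1: "\<theta> < 1"
    using \<theta> by linarith
  have "0 < s * measure lebesgue Q"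
    using F_small measure_nonneg[of lebesgue F] by linarith
  then have "0 < s"
    using measure_cube_pos[OF Suc.prems(1)] by (simp add: zero_less_mult_iff)
  \<comment> \<open>A negative threshold would make \<open>F\<close> all of \<open>Q\<close>,
    against its smallness. Nonnegativity makes the levels increase with \<open>k\<close>, whence
    \<open>X \<subseteq> F\<close>.\<close>
  have "0 \<le> \<mu>"
  proof (rule ccontr)
    assume "\<not> 0 \<le> \<mu>"
    then have "F = Q"
      by (auto simp: F_def)
    then show False
      using F_small s(1) measure_cube_pos[OF Suc.prems(1)] by simp
  qed
  obtain \<D> where \<D>: "countable \<D>" "disjoint \<D>" "negligible (F - \<Union>\<D>)"
    and stop: "\<forall>D\<in>\<D>. D \<in> lmeasurable \<and> (\<exists>K. cube K \<and> D \<subseteq> K \<and> K \<subseteq> Q \<and> negligible (K - D)) \<and>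
      \<theta> * measure lebesgue D < measure lebesgue (F \<inter> D) \<and>
      measure lebesgue (F \<inter> D) \<le> \<theta> * 2 ^ DIM('a) * measure lebesgue D"
    using calderon_zygmund[OF Suc.prems(1) F \<theta>(1) \<theta>1 small] by (elim exE conjE)
  have D_meas: "D \<in> lmeasurable"
    and D_cube: "\<exists>K. cube K \<and> D \<subseteq> K \<and> K \<subseteq> Q \<and> negligible (K - D)"
    and D_low: "\<theta> * measure lebesgue D < measure lebesgue (F \<inter> D)"
    and D_up: "measure lebesgue (F \<inter> D) \<le> \<theta> * 2 ^ DIM('a) * measure lebesgue D" if "D \<in> \<D>" for D
    using bspec[OF stop that] by simp_all
  have D_sub: "D \<subseteq> Q" if "D \<in> \<D>" for D
    using D_cube[OF that] by blast
  have U: "\<Union>\<D> \<in> sets lebesgue" "\<Union>\<D> \<subseteq> Q"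
    using D_meas D_sub \<D>(1) by (auto intro!: sets.countable_Union)
  have Um: "\<Union>\<D> \<in> lmeasurable"
    using U Qm fmeasurableI2 by blast
  define X where "X = {y\<in>Q - E. \<bar>f y - c\<bar> > \<mu> + 2 * \<mu> * real (Suc k)}"
  have X_eq: "X = {y\<in>Q. \<bar>f y - c\<bar> > \<mu> + 2 * \<mu> * real (Suc k)} - E"
    unfolding X_def by blast
  have "X \<in> sets lebesgue"
    unfolding X_eq by (intro sets.Diff f Suc.prems E)
  moreover have "0 \<le> 2 * \<mu> * real (Suc k)"
    using \<open>0 \<le> \<mu>\<close> by (intro mult_nonneg_nonneg) simp_all
  then have "\<mu> \<le> \<mu> + 2 * \<mu> * real (Suc k)"
    by linarith
  then have "X \<subseteq> F"
    unfolding X_def F_def by (auto intro: le_less_trans)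
  ultimately have X: "X \<in> sets lebesgue" "X \<subseteq> F"
    by blast+
  \<comment> \<open>Summing the lower density bound over the disjoint cells gives
    \<open>|\<Union>\<D>| \<le> |F| / \<theta> \<le> (s / \<theta>) |Q|\<close>, which is the
    smallness that \<open>halving\<close> asks for.\<close>
  have "emeasure lebesgue (UNIV \<inter> \<Union>\<D>) \<le> ennreal (1 / \<theta>) * emeasure lebesgue (F \<inter> \<Union>\<D>)"
  proof (rule emeasure_countable_disjoint_le[OF \<D>(1,2)])
    fix D assume D: "D \<in> \<D>"
    show "UNIV \<inter> D \<in> sets lebesgue" "F \<inter> D \<in> sets lebesgue"
      using D_meas[OF D] F by auto
    have "F \<inter> D \<in> lmeasurable"
      using Fm D_meas[OF D] by (intro fmeasurable_Int_fmeasurable) auto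
    moreover have "measure lebesgue D \<le> 1 / \<theta> * measure lebesgue (F \<inter> D)"
      using D_low[OF D] \<theta>(1) by (simp add: field_simps)
    ultimately show "emeasure lebesgue (UNIV \<inter> D) \<le> ennreal (1 / \<theta>) * emeasure lebesgue (F \<inter> D)"
      using D_meas[OF D] \<theta>(1) by (simp add: emeasure_eq_measure2 flip: ennreal_mult)
  qed
  also have "\<dots> \<le> ennreal (1 / \<theta>) * emeasure lebesgue F"
    using F(1) by (intro mult_left_mono emeasure_mono) auto
  finally have "measure lebesgue (\<Union>\<D>) \<le> 1 / \<theta> * measure lebesgue F"
    using Um Fm \<theta>(1) by (simp add: emeasure_eq_measure2 flip: ennreal_mult)
  then have "\<theta> * measure lebesgue (\<Union>\<D>) \<le> s * measure lebesgue Q"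
    using F_small \<theta>(1) by (simp add: field_simps)
  then have half: "emeasure \<nu> (\<Union>\<D>) \<le> ennreal (1/2) * emeasure \<nu> Q"
    using halving[OF Suc.prems(1,2) U] by simp
  have step: "emeasure \<nu> (X \<inter> D) \<le> ennreal ((1/2) ^ k) * emeasure \<nu> (UNIV \<inter> D)" if D: "D \<in> \<D>" for D
  proof (cases "D \<subseteq> E")
    case True
    then have "X \<inter> D = {}"
      by (auto simp: X_def)
    then show ?thesis
      by simp
  next
    case False
    \<comment> \<open>The oscillation hypothesis and the induction hypothesis concern closed cubes,
      so the cell \<open>D\<close> is replaced by its closed version \<open>K\<close>, which is not
      inside \<open>E\<close> either.\<close>
    obtain K where K: "cube K" "D \<subseteq> K" "K \<subseteq> Q" "negligible (K - D)"
      using D_cube[OF D] by blast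
    have K0: "K \<subseteq> Q0" "\<not> K \<subseteq> E"
      using K Suc.prems(2) False by auto
    obtain c' where c': "measure lebesgue {y\<in>K. \<bar>f y - c'\<bar> > \<mu>} < s * measure lebesgue K"
      using osc[OF K(1) K0] by blast
    define F' where "F' = {y\<in>K. \<bar>f y - c'\<bar> > \<mu>}"
    have Km: "K \<in> lmeasurable"
      by (rule cube_lmeasurable) fact
    have F': "F' \<in> lmeasurable"
      using f[OF K(1) K0(1)] Km unfolding F'_def by (intro fmeasurableI2[OF Km]) auto
    have FK: "F \<inter> K \<in> lmeasurable"
      using Fm Km by (intro fmeasurable_Int_fmeasurable) auto
    have "measure lebesgue (F \<inter> D) = measure lebesgue (F \<inter> K)"
      using K(2) FK fmeasurable_Int_fmeasurable[OF Fm fmeasurableD[OF D_meas[OF D]]]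
      by (intro measure_negligible_symdiff negligible_subset[OF K(4)]) auto
    moreover have KD: "measure lebesgue D = measure lebesgue K"
      using K Km D_meas[OF D]
      by (intro measure_negligible_symdiff) (auto simp: Diff_eq_empty_iff[THEN iffD2] Un_absorb1)
    moreover have "\<theta> * 2 ^ DIM('a) * measure lebesgue D \<le> 1/2 * measure lebesgue D"
      using \<theta>(2) by (intro mult_right_mono) auto
    ultimately have FK_small: "measure lebesgue (F \<inter> K) \<le> 1/2 * measure lebesgue K"
      using D_up[OF D] by linarith
    have "s * measure lebesgue K \<le> 1/2 * measure lebesgue K"
      using s(1) by (intro mult_right_mono) auto
    \<comment> \<open>\<open>F\<close> fills at most half of \<open>K\<close> and \<open>F'\<close>
      less than half, so some point of \<open>K\<close> avoids both. There \<open>f\<close> is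
      within \<open>\<mu>\<close> of both centers, whence
      \<open>|c - c'| \<le> 2 * \<mu>\<close>.\<close>
    then have "measure lebesgue (F \<inter> K \<union> F') < measure lebesgue K"
      using measure_Un_le[OF fmeasurableD[OF FK] fmeasurableD[OF F']] FK_small c'
      unfolding F'_def by linarith
    moreover have "F \<inter> K \<union> F' \<subseteq> K"
      by (auto simp: F'_def)
    ultimately obtain y where "y \<in> K" "y \<notin> F" "y \<notin> F'"
      by (metis IntI UnI1 UnI2 less_irrefl subset_antisym subsetI)
    then have "\<bar>f y - c\<bar> \<le> \<mu>" "\<bar>f y - c'\<bar> \<le> \<mu>"
      using K(3) by (auto simp: F_def F'_def)
    then have cc': "\<bar>c - c'\<bar> \<le> 2 * \<mu>"
      by linarith
    have "X \<inter> D \<subseteq> {y\<in>K - E. \<bar>f y - c'\<bar> > \<mu> + 2 * \<mu> * real k}"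
    proof
      fix y assume y: "y \<in> X \<inter> D"
      then have "\<bar>f y - c\<bar> > \<mu> + 2 * \<mu> * real k + 2 * \<mu>"
        by (auto simp: X_def algebra_simps)
      then have "\<bar>f y - c'\<bar> > \<mu> + 2 * \<mu> * real k"
        using cc' by linarith
      then show "y \<in> {y\<in>K - E. \<bar>f y - c'\<bar> > \<mu> + 2 * \<mu> * real k}"
        using y K(2) by (auto simp: X_def)
    qed
    moreover have "{y\<in>K - E. \<bar>f y - c'\<bar> > \<mu> + 2 * \<mu> * real k} \<in> sets \<nu>"
    proof -
      have "{y\<in>K - E. \<bar>f y - c'\<bar> > \<mu> + 2 * \<mu> * real k} = {y\<in>K. \<bar>f y - c'\<bar> > \<mu> + 2 * \<mu> * real k} - E"
        by auto
      then show ?thesis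
        using f[OF K(1) K0(1)] E K0(1) by (intro sets) auto
    qed
    ultimately have "emeasure \<nu> (X \<inter> D) \<le> emeasure \<nu> {y\<in>K - E. \<bar>f y - c'\<bar> > \<mu> + 2 * \<mu> * real k}"
      by (rule emeasure_mono)
    also have "\<dots> \<le> ennreal ((1/2) ^ k) * emeasure \<nu> K"
      by (rule Suc.IH[OF K(1) K0(1) c'])
    also have "emeasure \<nu> K = emeasure \<nu> D"
    proof -
      have "D \<in> sets \<nu>" "K - D \<in> sets \<nu>"
        using K K0(1) D_meas[OF D] Km by (auto intro!: sets)
      moreover have "emeasure \<nu> (K - D) = 0"
        using K0(1) K(4) by (intro null) auto
      moreover have "K = D \<union> (K - D)"
        using K(2) by blast
      ultimately show ?thesis
        by (metis emeasure_Un_null_set null_setsI)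
    qed
    finally show ?thesis
      by simp
  qed
  have UQ: "X \<inter> \<Union>\<D> \<in> sets \<nu>" "X - \<Union>\<D> \<in> sets \<nu>" "F - \<Union>\<D> \<in> sets \<nu>"
    using X U F Suc.prems(2) by (auto intro!: sets)
  have "emeasure \<nu> (X - \<Union>\<D>) = 0"
    using X(2) F(2) Suc.prems(2) by (intro null negligible_subset[OF \<D>(3)]) auto
  then have "emeasure \<nu> X = emeasure \<nu> (X \<inter> \<Union>\<D>)"
    using emeasure_Un_null_set[OF UQ(1) null_setsI[OF _ UQ(2)]] by (simp add: Int_Diff_Un)
  also have "\<dots> \<le> ennreal ((1/2) ^ k) * emeasure \<nu> (UNIV \<inter> \<Union>\<D>)"
  proof (rule emeasure_countable_disjoint_le[OF \<D>(1,2) _ _ step])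
    fix D assume D: "D \<in> \<D>"
    show "X \<inter> D \<in> sets \<nu>" "UNIV \<inter> D \<in> sets \<nu>"
      using D_sub[OF D] D_meas[OF D] X Suc.prems(2) by (auto intro!: sets)
  qed
  also have "\<dots> \<le> ennreal ((1/2) ^ k) * (ennreal (1/2) * emeasure \<nu> Q)"
    using half by (intro mult_left_mono) auto
  also have "\<dots> = ennreal ((1/2) ^ Suc k) * emeasure \<nu> Q"
  proof -
    have "ennreal ((1/2) ^ Suc k) = ennreal ((1/2) ^ k) * ennreal (1/2)"
      by (subst ennreal_mult[symmetric]) simp_all
    then show ?thesis
      by (simp only: mult.assoc)
  qed
  finally show ?case
    by (simp add: X_def)
qed

section \<open>Measurability of unions of cubes\<close>

text \<open>Translates of a bounded piece of \<open>A\<close> by distinct multiples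
  \<open>r n\<close> of \<open>v\<close> in \<open>(0, \<delta>)\<close> are pairwise disjoint,
  because differences of the multiples again have modulus below \<open>\<delta>\<close>. They are
  infinitely many, of equal measure, and lie in one ball, so this measure is 0.\<close>

lemma negligible_no_translates:
  fixes A :: "'a::euclidean_space set"
  assumes A: "A \<in> sets lebesgue" and "\<delta> > 0"
    and no: "\<And>x t. x \<in> A \<Longrightarrow> 0 < t \<Longrightarrow> t < \<delta> \<Longrightarrow> x + t *\<^sub>R v \<notin> A"
  shows "negligible A"
proof (rule iffD2[OF negligible_on_intervals], intro allI)
  fix a b :: 'a
  define B where "B = A \<inter> cbox a b"
  define r where "r n = \<delta> / (real n + 2)" for n
  have r: "0 < r n" "r n < \<delta>" for n
    using \<open>\<delta> > 0\<close> by (auto simp: r_def field_simps intro: add_pos_nonneg)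
  have B: "B \<in> lmeasurable"
    using A fmeasurable_Int_fmeasurable[OF lmeasurable_cbox, of A a b] by (simp add: B_def Int_commute)
  define T where "T n = (+) (r n *\<^sub>R v) ` B" for n
  have T: "T n \<in> lmeasurable" "measure lebesgue (T n) = measure lebesgue B" for n
    using B by (auto simp: T_def measurable_translation measure_translation)
  have lt: "T m \<inter> T n = {}" if "r m < r n" for m n
  proof (rule ccontr)
    assume "T m \<inter> T n \<noteq> {}"
    then obtain x y where "x \<in> B" "y \<in> B" "r m *\<^sub>R v + x = r n *\<^sub>R v + y"
      by (auto simp: T_def)
    then have "y \<in> A" "y + (r n - r m) *\<^sub>R v \<in> A"
      by (auto simp: B_def scaleR_diff_left) (metis add.commute add_diff_eq add_diff_cancel_left')
    moreover have "r n - r m < \<delta>"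
      using r[of m] r[of n] by linarith
    ultimately show False
      using no[of y "r n - r m"] that by simp
  qed
  have "inj r"
    using \<open>\<delta> > 0\<close> by (auto simp: inj_def r_def field_simps)
  have disj: "disjoint_family T"
    unfolding disjoint_family_on_def
    by (metis lt inf_commute linorder_less_linear injD[OF \<open>inj r\<close>])
  obtain M where M: "\<And>x. x \<in> cbox a b \<Longrightarrow> norm x \<le> M"
    using bounded_cbox bounded_iff by metis
  have "T n \<subseteq> cball 0 (\<delta> * norm v + M)" for n
  proof
    fix y assume "y \<in> T n"
    then obtain x where x: "x \<in> cbox a b" "y = r n *\<^sub>R v + x"
      by (auto simp: T_def B_def)
    have "norm y \<le> r n * norm v + norm x"
      using norm_triangle_ineq[of "r n *\<^sub>R v" x] r[of n] x by simp
    also have "\<dots> \<le> \<delta> * norm v + M"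
      using M x r[of n] by (intro add_mono mult_right_mono) auto
    finally show "y \<in> cball 0 (\<delta> * norm v + M)"
      by simp
  qed
  then have "(\<Union>n. T n) \<subseteq> cball 0 (\<delta> * norm v + M)"
    by blast
  then have "(\<Union>n. T n) \<in> lmeasurable"
    by (rule fmeasurableI2[OF lmeasurable_cball]) (use T(1) in auto)
  then have "emeasure lebesgue (\<Union>n. T n) < \<infinity>"
    using fmeasurableD2 less_top infinity_ennreal_def by metis
  moreover have "(\<Sum>n. emeasure lebesgue (T n)) = emeasure lebesgue (\<Union>n. T n)"
    using T(1) by (intro suminf_emeasure disj) auto
  moreover have "emeasure lebesgue (T n) = ennreal (measure lebesgue B)" for n
    using T[of n] by (simp add: emeasure_eq_measure2)
  ultimately have "(\<Sum>n::nat. ennreal (measure lebesgue B)) < \<infinity>"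
    by simp
  then have "summable (\<lambda>n::nat. measure lebesgue B)"
    by (intro summable_suminf_not_top) auto
  then have "measure lebesgue B = 0"
    by (simp add: summable_const_iff)
  then show "negligible (A \<inter> cbox a b)"
    using B by (simp add: negligible_iff_measure B_def)
qed

text \<open>
  A boundary point of a union \<open>V\<close> of open cubes of side at least \<open>2\<delta>\<close> sees, in the direction of one
  of the \<open>2\<^sup>d\<close> open orthants, only points of \<open>V\<close> at distance less than \<open>\<delta>\<close>; the set of such points
  outside \<open>V\<close> is disjoint from its small translates in that direction.
\<close>

lemma sets_lebesgue_Union_cubes:
  fixes \<Q> :: "'a::euclidean_space set set"
  assumes \<Q>: "\<And>Q. Q \<in> \<Q> \<Longrightarrow> cube Q"
  shows "\<Union>\<Q> \<in> sets lebesgue"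
proof -
  define V where "V = (\<Union>Q\<in>\<Q>. interior Q)"
  have "open V"
    by (auto simp: V_def)
  \<comment> \<open>For a sign vector \<open>\<sigma>\<close>, \<open>B \<delta> \<sigma>\<close> is
    the open cube of side \<open>\<delta>\<close> with a vertex at the origin, lying in the orthant
    of \<open>\<sigma>\<close>.\<close>
  define B where "B \<delta> \<sigma> = {z. \<forall>i\<in>Basis. 0 < (z \<bullet> i) * (\<sigma> \<bullet> i) \<and> (z \<bullet> i) * (\<sigma> \<bullet> i) < \<delta>}"
    for \<delta> :: real and \<sigma> :: 'a
  define A where "A \<delta> \<sigma> = {x. x \<notin> V \<and> (\<forall>z\<in>B \<delta> \<sigma>. x + z \<in> V)}" for \<delta> \<sigma>
  define \<Sigma> where "\<Sigma> = {\<sigma>::'a. \<forall>i\<in>Basis. \<sigma> \<bullet> i = 1 \<or> \<sigma> \<bullet> i = -1}"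
  \<comment> \<open>A sign vector is determined by the set of coordinates where it is 1, so there
    are finitely many.\<close>
  have "\<sigma> = (\<Sum>i\<in>Basis. (if i \<in> {i\<in>Basis. \<sigma> \<bullet> i = 1} then 1 else -1) *\<^sub>R i)" if "\<sigma> \<in> \<Sigma>" for \<sigma>
    by (rule euclidean_eqI, subst inner_sum_left_Basis) (use that in \<open>auto simp: \<Sigma>_def\<close>)
  then have "\<Sigma> \<subseteq> (\<lambda>S. \<Sum>i\<in>Basis. (if i \<in> S then 1 else -1) *\<^sub>R i) ` Pow Basis"
    by (intro subsetI, rule_tac x = "{i\<in>Basis. x \<bullet> i = 1}" in image_eqI) blast+
  then have "finite \<Sigma>"
    by (rule finite_subset) simp
  have "open (B \<delta> \<sigma>)" for \<delta> \<sigma>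
  proof -
    have "B \<delta> \<sigma> = (\<Inter>i\<in>Basis. {z. 0 < (z \<bullet> i) * (\<sigma> \<bullet> i)} \<inter> {z. (z \<bullet> i) * (\<sigma> \<bullet> i) < \<delta>})"
      by (auto simp: B_def)
    then show ?thesis
      by (auto intro!: open_INT open_Int open_Collect_less continuous_intros)
  qed
  \<comment> \<open>The points \<open>x\<close> for which \<open>x + z\<close> leaves
    \<open>V\<close> for some \<open>z\<close> in \<open>B \<delta> \<sigma>\<close> form a union of
    translates of the open set \<open>- B \<delta> \<sigma>\<close>. Removing this open set from the
    closed set \<open>- V\<close> leaves \<open>A \<delta> \<sigma>\<close>, which is therefore
    Borel.\<close>
  then have "open {v - z |v z. v \<in> - V \<and> z \<in> B \<delta> \<sigma>}" for \<delta> \<sigma>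
  proof -
    have "{v - z |v z. v \<in> - V \<and> z \<in> B \<delta> \<sigma>} = (\<Union>v\<in>-V. (+) v ` uminus ` B \<delta> \<sigma>)"
      by (auto simp: image_image)
    then show ?thesis
      using \<open>open (B \<delta> \<sigma>)\<close> by (simp only:) (intro open_UN ballI open_translation open_negations)
  qed
  moreover have "A \<delta> \<sigma> = - V - {v - z |v z. v \<in> - V \<and> z \<in> B \<delta> \<sigma>}" for \<delta> \<sigma>
    by (auto simp: A_def) (metis add_diff_cancel_right')
  ultimately have "A \<delta> \<sigma> \<in> sets borel" for \<delta> \<sigma>
    using \<open>open V\<close> by auto
  then have meas: "A \<delta> \<sigma> \<in> sets lebesgue" for \<delta> \<sigma>
    by (rule sets_completionI_sets[of _ lborel, simplified])
  have negl: "negligible (A \<delta> \<sigma>)" if "\<sigma> \<in> \<Sigma>" "\<delta> > 0" for \<delta> \<sigma>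
  proof (rule negligible_no_translates[OF meas that(2)])
    fix x t assume x: "x \<in> A \<delta> \<sigma>" "0 < t" "t < \<delta>"
    have "(t *\<^sub>R \<sigma> \<bullet> i) * (\<sigma> \<bullet> i) = t" if "i \<in> Basis" for i
      using \<open>\<sigma> \<in> \<Sigma>\<close> that by (auto simp: \<Sigma>_def)
    then have "t *\<^sub>R \<sigma> \<in> B \<delta> \<sigma>"
      using x by (simp add: B_def mult.assoc)
    then show "x + t *\<^sub>R \<sigma> \<notin> A \<delta> \<sigma>"
      using x by (auto simp: A_def)
  qed
  have cover: "\<Union>\<Q> - V \<subseteq> (\<Union>n. \<Union>\<sigma>\<in>\<Sigma>. A (1 / Suc n) \<sigma>)"
  proof
    fix x assume x: "x \<in> \<Union>\<Q> - V"
    then obtain Q where Q: "Q \<in> \<Q>" "x \<in> Q"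
      by blast
    then obtain a l where l: "l > 0" "Q = cbox a (a + l *\<^sub>R One)"
      using \<Q> unfolding cube_def by metis
    obtain n where n: "1 / Suc n < l / 2"
      using nat_approx_posE[of "l / 2"] l by auto
    \<comment> \<open>In each coordinate the sign points from \<open>x\<close> towards the center of
      \<open>Q\<close>. A positive displacement below \<open>l / 2\<close> in that direction ends
      strictly between the two faces.\<close>
    define \<sigma> where "\<sigma> = (\<Sum>i\<in>Basis. (if x \<bullet> i < a \<bullet> i + l / 2 then 1 else -1) *\<^sub>R i :: 'a)"
    have \<sigma>: "\<sigma> \<bullet> i = (if x \<bullet> i < a \<bullet> i + l / 2 then 1 else -1)" if "i \<in> Basis" for i
      using that by (simp add: \<sigma>_def)
    have "x + z \<in> V" if z: "z \<in> B (1 / Suc n) \<sigma>" for z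
    proof -
      have "a \<bullet> i < (x + z) \<bullet> i \<and> (x + z) \<bullet> i < (a + l *\<^sub>R One) \<bullet> i" if i: "i \<in> Basis" for i
      proof -
        have "0 < (z \<bullet> i) * (\<sigma> \<bullet> i)" "(z \<bullet> i) * (\<sigma> \<bullet> i) < l / 2"
          using z i n unfolding B_def by (auto intro: less_trans)
        moreover have "a \<bullet> i \<le> x \<bullet> i" "x \<bullet> i \<le> a \<bullet> i + l"
          using Q(2) i l by (auto simp: mem_box inner_add_left)
        ultimately show ?thesis
          using i by (auto simp: \<sigma> inner_add_left split: if_splits)
      qed
      then have "x + z \<in> interior Q"
        by (simp add: l mem_box)
      then show ?thesis
        using Q by (auto simp: V_def)
    qed
    then have "x \<in> A (1 / Suc n) \<sigma>" "\<sigma> \<in> \<Sigma>"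
      using x \<sigma> by (auto simp: A_def \<Sigma>_def)
    then show "x \<in> (\<Union>n. \<Union>\<sigma>\<in>\<Sigma>. A (1 / Suc n) \<sigma>)"
      by blast
  qed
  have "negligible (\<Union>n. \<Union>\<sigma>\<in>\<Sigma>. A (1 / Suc n) \<sigma>)"
    using \<open>finite \<Sigma>\<close> negl by (intro negligible_countable_Union negligible_Union) auto
  then have "negligible (\<Union>\<Q> - V)"
    using cover negligible_subset by blast
  moreover have "\<Union>\<Q> = V \<union> (\<Union>\<Q> - V)"
    using interior_subset by (auto simp: V_def)
  moreover have "V \<in> sets lebesgue"
    using \<open>open V\<close> by auto
  ultimately show ?thesis
    using negligible_imp_sets sets.Un by metis
qed

section \<open>Lorentz--Zygmund functionals\<close>

lemma ennreal_power_mono: "x \<le> y \<Longrightarrow> r > 0 \<Longrightarrow> ennreal_power x r \<le> ennreal_power y r"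
  by (cases x; cases y) (auto simp: ennreal_power_def powr_mono2 ennreal_le_iff top_unique)

lemma ennreal_power_mult:
  assumes "0 < r" "0 \<le> a"
  shows "ennreal_power (ennreal a * x) r = ennreal (a powr r) * ennreal_power x r"
proof (cases "a = 0")
  case True
  then show ?thesis
    using assms by (simp add: ennreal_power_def)
next
  case False
  with assms show ?thesis
    by (cases x) (auto simp: ennreal_power_def powr_mult ennreal_mult_top simp flip: ennreal_mult)
qed

lemma rearrangement_antimono: "s \<le> t \<Longrightarrow> rearrangement M g t \<le> rearrangement M g s"
  unfolding rearrangement_def by (intro INF_superset_mono) (auto intro: order_trans ennreal_leI)

text \<open>Superlevel sets of a monotone function on the line are intervals.\<close>

lemma borel_measurable_rearrangement: "rearrangement M g \<in> borel_measurable borel"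
proof (rule borel_measurableI_greater)
  fix y
  have "is_interval {t. y < rearrangement M g t}"
    unfolding is_interval_1 using rearrangement_antimono[of _ _ M g] by (auto intro: less_le_trans)
  then show "{t \<in> space borel. y < rearrangement M g t} \<in> sets borel"
    by (simp add: real_interval_borel_measurable)
qed

lemma borel_measurable_ennreal_power:
  assumes "h \<in> borel_measurable M"
  shows "(\<lambda>x. ennreal_power (h x) r) \<in> borel_measurable M"
  using assms unfolding ennreal_power_def by measurable

lemma Lq_log_mono:
  assumes "0 < q" and "\<And>t. 0 < t \<Longrightarrow> t < 1 \<Longrightarrow> h t \<le> k t"
  shows "Lq_log q h \<le> Lq_log q k"
proof (cases "q = \<infinity>")
  case True
  then show ?thesis
    using assms by (auto simp: Lq_log_def intro!: SUP_mono bexI)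
next
  case False
  then have "0 < enn2real q"
    using assms(1) by (simp add: enn2real_positive_iff less_top)
  show ?thesis
  proof -
    have "ennreal_power (h t) (enn2real q) * ennreal (1 / t) * indicator {0<..<1} t
        \<le> ennreal_power (k t) (enn2real q) * ennreal (1 / t) * indicator {0<..<1} t" for t
      using assms(2)[of t] \<open>0 < enn2real q\<close>
      by (auto intro!: mult_right_mono ennreal_power_mono split: split_indicator)
    then show ?thesis
      using False \<open>0 < enn2real q\<close> unfolding Lq_log_def
      by (auto intro!: ennreal_power_mono nn_integral_mono)
  qed
qed

lemma Lq_log_cmult:
  assumes "0 < q" "0 \<le> A" and [measurable]: "h \<in> borel_measurable borel"
  shows "Lq_log q (\<lambda>t. ennreal A * h t) = ennreal A * Lq_log q h"
proof (cases "q = \<infinity>")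
  case True
  then show ?thesis
    by (simp add: Lq_log_def SUP_mult_left_ennreal)
next
  case False
  define r where "r = enn2real q"
  have r: "0 < r"
    using assms(1) False by (simp add: enn2real_positive_iff less_top r_def)
  note borel_measurable_ennreal_power[measurable]
  have "(\<integral>\<^sup>+t\<in>{0<..<1}. (ennreal_power (ennreal A * h t) r * ennreal (1 / t)) \<partial>lborel) =
      (\<integral>\<^sup>+t. ennreal (A powr r) * (ennreal_power (h t) r * ennreal (1 / t) * indicator {0<..<1} t) \<partial>lborel)"
    using r assms(2) by (simp add: ennreal_power_mult mult.assoc)
  also have "\<dots> = ennreal (A powr r) * (\<integral>\<^sup>+t\<in>{0<..<1}. (ennreal_power (h t) r * ennreal (1 / t)) \<partial>lborel)"
    by (rule nn_integral_cmult) measurable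
  finally show ?thesis
    using False r assms(2) by (simp add: Lq_log_def ennreal_power_mult powr_powr flip: r_def)
qed

text \<open>The measure \<open>dt / t\<close> is invariant under dilations, and
  \<open>t \<mapsto> \<kappa> t\<close> maps \<open>(0, 1)\<close> into itself, so the left side
  sees only a part of the domain on the right.\<close>

lemma Lq_log_dilation:
  assumes "0 < q" "0 < \<kappa>" "\<kappa> \<le> 1" and [measurable]: "h \<in> borel_measurable borel"
  shows "Lq_log q (\<lambda>t. h (\<kappa> * t)) \<le> Lq_log q h"
proof (cases "q = \<infinity>")
  case True
  have "(SUP t\<in>{0<..<1}. h (\<kappa> * t)) \<le> (SUP t\<in>{0<..<1}. h t)"
  proof (rule SUP_mono)
    fix t :: real assume t: "t \<in> {0<..<1}"
    then have "\<kappa> * t \<le> t"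
      using assms(2,3) by (intro mult_left_le_one_le) auto
    then have "\<kappa> * t < 1"
      by (rule le_less_trans) (use t in simp)
    then have "\<kappa> * t \<in> {0<..<1}"
      using t assms(2) by simp
    then show "\<exists>u\<in>{0<..<1}. h (\<kappa> * t) \<le> h u"
      by blast
  qed
  then show ?thesis
    using True by (simp add: Lq_log_def)
next
  case False
  define r where "r = enn2real q"
  have r: "0 < r"
    using assms(1) False by (simp add: enn2real_positive_iff less_top r_def)
  note borel_measurable_ennreal_power[measurable]
  \<comment> \<open>With the indicator inside \<open>F\<close> the integral runs over the whole
    line, where the affine substitution applies.\<close>
  define F where "F t = ennreal_power (h t) r * ennreal (1 / t) * indicator {0<..<1} t" for t
  have [measurable]: "F \<in> borel_measurable borel"
    unfolding F_def by measurable
  have "(\<integral>\<^sup>+t\<in>{0<..<1}. (ennreal_power (h (\<kappa> * t)) r * ennreal (1 / t)) \<partial>lborel)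
      \<le> (\<integral>\<^sup>+t. ennreal \<kappa> * F (0 + \<kappa> * t) \<partial>lborel)"
  proof (rule nn_integral_mono)
    fix t :: real
    show "ennreal_power (h (\<kappa> * t)) r * ennreal (1 / t) * indicator {0<..<1} t
        \<le> ennreal \<kappa> * F (0 + \<kappa> * t)"
    proof (cases "t \<in> {0<..<1}")
      case True
      then have "\<kappa> * t \<le> t"
        using assms(2,3) by (intro mult_left_le_one_le) auto
      then have "\<kappa> * t < 1"
        by (rule le_less_trans) (use True in simp)
      then have "\<kappa> * t \<in> {0<..<1}"
        using assms(2) True by simp
      moreover have "ennreal (1 / t) = ennreal \<kappa> * ennreal (1 / (\<kappa> * t))"
        using assms True by (simp flip: ennreal_mult)
      ultimately show ?thesis
        using True by (simp add: F_def mult_ac)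
    qed simp
  qed
  also have "\<dots> = ennreal \<kappa> * (\<integral>\<^sup>+t. F (0 + \<kappa> * t) \<partial>lborel)"
    by (rule nn_integral_cmult) measurable
  also have "\<dots> = (\<integral>\<^sup>+t. F t \<partial>lborel)"
    using nn_integral_real_affine[of F \<kappa> 0] assms by simp
  finally show ?thesis
    using False r unfolding Lq_log_def by (auto intro!: ennreal_power_mono simp: F_def r_def)
qed

text \<open>Expanding the product shows
  \<open>1 - ln \<kappa> - ln t \<le> (1 - ln \<kappa>) (1 - ln t)\<close>, both logarithms being
  nonpositive. The exponent \<open>b \<le> 0\<close> reverses this inequality.\<close>

lemma log_weight_dilation:
  fixes \<kappa> t b :: real
  assumes "0 < \<kappa>" "\<kappa> \<le> 1" "0 < t" "t < 1" "b \<le> 0"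
  shows "(1 - ln t) powr b \<le> (1 - ln \<kappa>) powr (- b) * (1 + \<bar>ln (\<kappa> * t)\<bar>) powr b"
proof -
  have ln: "ln \<kappa> \<le> 0" "ln t < 0"
    using assms by auto
  have eq: "1 + \<bar>ln (\<kappa> * t)\<bar> = 1 - ln \<kappa> - ln t"
    using assms ln add_nonpos_neg[OF ln] by (simp add: ln_mult)
  have "0 \<le> ln \<kappa> * ln t"
    using ln by (intro mult_nonpos_nonpos) auto
  then have "1 + \<bar>ln (\<kappa> * t)\<bar> \<le> (1 - ln \<kappa>) * (1 - ln t)"
    unfolding eq by (simp add: algebra_simps)
  then have "((1 - ln \<kappa>) * (1 - ln t)) powr b \<le> (1 + \<bar>ln (\<kappa> * t)\<bar>) powr b"
    using assms(5) by (intro powr_mono2') auto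
  then have "(1 - ln \<kappa>) powr (- b) * ((1 - ln \<kappa>) powr b * (1 - ln t) powr b)
      \<le> (1 - ln \<kappa>) powr (- b) * (1 + \<bar>ln (\<kappa> * t)\<bar>) powr b"
    using ln by (intro mult_left_mono) (simp_all add: powr_mult)
  moreover have "(1 - ln \<kappa>) powr (- b) * ((1 - ln \<kappa>) powr b * (1 - ln t) powr b) = (1 - ln t) powr b"
    using ln by (simp add: powr_minus)
  ultimately show ?thesis
    by simp
qed

text \<open>The step from a pointwise bound to a norm inequality. It is stated for an arbitrary
  \<open>h\<close> so as to serve both the functional with the inner supremum and the norm with
  exponent \<open>b - 1\<close>.\<close>

lemma LZ_norm_dilation:
  assumes "0 < q" "0 < \<kappa>" "\<kappa> \<le> 1" "b \<le> 0" "0 \<le> A"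
    and h: "\<And>t. 0 < t \<Longrightarrow> t < 1 \<Longrightarrow>
      h t \<le> ennreal (A * (1 - ln t) powr b) * rearrangement M g (\<kappa> * t)"
  shows "Lq_log q h \<le> ennreal (A * (1 - ln \<kappa>) powr (- b)) * LZ_norm M q b g"
proof -
  define G where "G t = ennreal ((1 + \<bar>ln t\<bar>) powr b) * rearrangement M g t" for t
  note borel_measurable_rearrangement[measurable]
  have G[measurable]: "G \<in> borel_measurable borel"
    unfolding G_def by measurable
  define B where "B = A * (1 - ln \<kappa>) powr (- b)"
  have "0 \<le> B"
    using assms by (simp add: B_def)
  have "Lq_log q h \<le> Lq_log q (\<lambda>t. ennreal B * G (\<kappa> * t))"
  proof (rule Lq_log_mono[OF assms(1)])
    fix t :: real assume t: "0 < t" "t < 1"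
    have "A * (1 - ln t) powr b \<le> A * ((1 - ln \<kappa>) powr (- b) * (1 + \<bar>ln (\<kappa> * t)\<bar>) powr b)"
      using log_weight_dilation[OF assms(2,3) t assms(4)] assms(5) by (rule mult_left_mono)
    then have "ennreal (A * (1 - ln t) powr b) \<le> ennreal B * ennreal ((1 + \<bar>ln (\<kappa> * t)\<bar>) powr b)"
      using \<open>0 \<le> B\<close> by (simp add: B_def mult.assoc ennreal_leI flip: ennreal_mult)
    then have "ennreal (A * (1 - ln t) powr b) * rearrangement M g (\<kappa> * t)
        \<le> ennreal B * ennreal ((1 + \<bar>ln (\<kappa> * t)\<bar>) powr b) * rearrangement M g (\<kappa> * t)"
      by (rule mult_right_mono) simp
    then show "h t \<le> ennreal B * G (\<kappa> * t)"
      using h[OF t] by (simp add: G_def mult.assoc)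
  qed
  also have "\<dots> = ennreal B * Lq_log q (\<lambda>t. G (\<kappa> * t))"
    by (rule Lq_log_cmult[OF assms(1) \<open>0 \<le> B\<close>]) measurable
  also have "\<dots> \<le> ennreal B * Lq_log q G"
    by (intro mult_left_mono Lq_log_dilation assms G) simp
  finally show ?thesis
    by (simp add: B_def LZ_norm_def G_def[abs_def])
qed

section \<open>Comparison of the maximal functions\<close>

text \<open>Reduces a bound by a rearrangement to a bound by each admissible level. An empty set of
  levels, with infimum \<open>\<infinity>\<close>, is covered.\<close>

lemma ennreal_le_mult_INF:
  assumes "0 < B" and "\<And>a. a \<in> S \<Longrightarrow> x \<le> ennreal B * F a"
  shows "x \<le> ennreal B * (INF a\<in>S. F a)"
proof -
  have inv: "ennreal (1 / B) * (ennreal B * y) = y" "ennreal B * (ennreal (1 / B) * y) = y" for y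
    using assms(1) by (simp_all add: mult.assoc[symmetric] flip: ennreal_mult)
  have "ennreal (1 / B) * x \<le> F a" if "a \<in> S" for a
    using mult_left_mono[OF assms(2)[OF that], of "ennreal (1 / B)"] by (simp only: inv zero_le)
  then have "ennreal (1 / B) * x \<le> (INF a\<in>S. F a)"
    by (rule INF_greatest)
  then show ?thesis
    using mult_left_mono[of "ennreal (1 / B) * x" _ "ennreal B"] by (simp only: inv zero_le)
qed

text \<open>The level set is the union of the admissible cubes on which \<open>\<Phi>\<close>
  exceeds \<open>a\<close>. These cubes are closed and possibly uncountably many, so measurability
  rests on the result about arbitrary unions of cubes.\<close>

lemma sets_lebesgue_maximal_level:
  "{x \<in> Q0. (SUP Q\<in>{Q. cube Q \<and> x \<in> Q \<and> Q \<subseteq> Q0}. \<Phi> Q) > (a :: ennreal)} \<in> sets lebesgue"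
proof -
  have "{x \<in> Q0. (SUP Q\<in>{Q. cube Q \<and> x \<in> Q \<and> Q \<subseteq> Q0}. \<Phi> Q) > a} =
      \<Union>{Q. cube Q \<and> Q \<subseteq> Q0 \<and> \<Phi> Q > a}"
    by (auto simp: less_SUP_iff)
  then show ?thesis
    using sets_lebesgue_Union_cubes[of "{Q. cube Q \<and> Q \<subseteq> Q0 \<and> \<Phi> Q > a}"] by simp
qed

text \<open>The infima over centers and levels need not be attained; a threshold
  \<open>\<mu>\<close> strictly above \<open>\<alpha>\<close> leaves room to pick a center with a
  level below \<open>\<mu>\<close>.\<close>

lemma oscillation_of_local_sharp_maximal:
  assumes f: "\<And>c \<alpha>. {y\<in>Q. \<bar>f y - c\<bar> > \<alpha>} \<in> sets lebesgue"
    and Q: "cube Q" "x \<in> Q" "Q \<subseteq> Q0" and s: "0 \<le> s"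
    and le: "local_sharp_maximal s Q0 f x \<le> ennreal \<alpha>" and "0 \<le> \<alpha>" "\<alpha> < \<mu>"
  shows "\<exists>c. measure lebesgue {y\<in>Q. \<bar>f y - c\<bar> > \<mu>} < s * measure lebesgue Q"
proof -
  have "(INF c::real. INF \<alpha>\<in>{\<alpha>::real. 0 \<le> \<alpha> \<and>
      emeasure lebesgue {y \<in> Q. \<bar>f y - c\<bar> > \<alpha>} < ennreal s * emeasure lebesgue Q}. ennreal \<alpha>)
      \<le> local_sharp_maximal s Q0 f x"
    unfolding local_sharp_maximal_def by (rule SUP_upper) (use Q in simp)
  also have "\<dots> < ennreal \<mu>"
    using le \<open>0 \<le> \<alpha>\<close> \<open>\<alpha> < \<mu>\<close> by (auto intro: le_less_trans simp: ennreal_less_iff)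
  finally obtain c \<alpha>' where c: "0 \<le> \<alpha>'" "ennreal \<alpha>' < ennreal \<mu>"
      "emeasure lebesgue {y \<in> Q. \<bar>f y - c\<bar> > \<alpha>'} < ennreal s * emeasure lebesgue Q"
    by (auto simp: INF_less_iff)
  have "\<alpha>' < \<mu>"
    using c(1,2) by (simp add: ennreal_less_iff)
  have Qm: "Q \<in> lmeasurable"
    by (rule cube_lmeasurable[OF Q(1)])
  have "emeasure lebesgue {y \<in> Q. \<bar>f y - c\<bar> > \<mu>} \<le> emeasure lebesgue {y \<in> Q. \<bar>f y - c\<bar> > \<alpha>'}"
    by (rule emeasure_mono[OF _ f]) (use \<open>\<alpha>' < \<mu>\<close> in auto)
  then have "emeasure lebesgue {y \<in> Q. \<bar>f y - c\<bar> > \<mu>} < ennreal s * emeasure lebesgue Q"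
    using c(3) by (rule le_less_trans)
  moreover have "{y \<in> Q. \<bar>f y - c\<bar> > \<mu>} \<in> lmeasurable"
    by (rule fmeasurableI2[OF Qm _ f]) auto
  ultimately have "measure lebesgue {y \<in> Q. \<bar>f y - c\<bar> > \<mu>} < s * measure lebesgue Q"
    using Qm s by (simp add: emeasure_eq_measure2 ennreal_less_iff flip: ennreal_mult)
  then show ?thesis
    by blast
qed

text \<open>The centers supplied by the oscillation bound depend on the threshold and thus on
  \<open>t\<close>, while the constant subtracted from \<open>f\<close> must not. A median is fixed
  once and lies within \<open>\<mu>\<close> of every center \<open>c\<close> for which
  \<open>{|f - c| > \<mu>}\<close> fills less than half of \<open>Q\<close>.\<close>

lemma median_near_centers:
  fixes f :: "'a::euclidean_space \<Rightarrow> real"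
  assumes f: "\<And>c \<alpha>. {y\<in>Q. \<bar>f y - c\<bar> > \<alpha>} \<in> sets lebesgue"
    and f_gt: "\<And>\<alpha>. {y\<in>Q. f y > \<alpha>} \<in> sets lebesgue" and Q: "Q \<in> lmeasurable"
  shows "\<exists>m. \<forall>c \<mu>. measure lebesgue {y\<in>Q. \<bar>f y - c\<bar> > \<mu>} < 1/2 * measure lebesgue Q \<longrightarrow> \<bar>m - c\<bar> \<le> \<mu>"
proof -
  \<comment> \<open>\<open>Inf S\<close> is the lower median. The hypothesis on a center
    \<open>c\<close> puts \<open>c + \<mu>\<close> into \<open>S\<close> and makes
    \<open>c - \<mu>\<close> a lower bound of \<open>S\<close>: for smaller \<open>m\<close>, the
    sets \<open>{f > m}\<close> and \<open>B\<close> would cover \<open>Q\<close> with total measure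
    below that of \<open>Q\<close>.\<close>
  define S where "S = {m. measure lebesgue {y\<in>Q. f y > m} \<le> 1/2 * measure lebesgue Q}"
  have "\<bar>Inf S - c\<bar> \<le> \<mu>" if "measure lebesgue {y\<in>Q. \<bar>f y - c\<bar> > \<mu>} < 1/2 * measure lebesgue Q" for c \<mu>
  proof -
    define B where "B = {y\<in>Q. \<bar>f y - c\<bar> > \<mu>}"
    have small: "measure lebesgue B < 1/2 * measure lebesgue Q"
      using that by (simp add: B_def)
    have B: "B \<in> lmeasurable"
      unfolding B_def by (rule fmeasurableI2[OF Q _ f]) auto
    have G: "{y\<in>Q. f y > m} \<in> lmeasurable" for m
      by (rule fmeasurableI2[OF Q _ f_gt]) auto
    have "measure lebesgue {y\<in>Q. f y > c + \<mu>} \<le> measure lebesgue B"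
      by (rule measure_mono_fmeasurable[OF _ fmeasurableD[OF G] B]) (auto simp: B_def)
    then have up: "c + \<mu> \<in> S"
      using small by (simp add: S_def)
    have low: "c - \<mu> \<le> m" if m: "m \<in> S" for m
    proof (rule ccontr)
      assume "\<not> c - \<mu> \<le> m"
      then have "Q \<subseteq> {y\<in>Q. f y > m} \<union> B"
        by (auto simp: B_def)
      then have "measure lebesgue Q \<le> measure lebesgue ({y\<in>Q. f y > m} \<union> B)"
        by (rule measure_mono_fmeasurable[OF _ fmeasurableD[OF Q] fmeasurable.Un[OF G B]])
      also have "\<dots> \<le> measure lebesgue {y\<in>Q. f y > m} + measure lebesgue B"
        by (rule measure_Un_le[OF fmeasurableD[OF G] fmeasurableD[OF B]])
      finally show False
        using small m by (simp add: S_def)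
    qed
    have "Inf S \<le> c + \<mu>"
      by (rule cInf_lower[OF up bdd_belowI[of _ "c - \<mu>"]]) (rule low)
    moreover have "c - \<mu> \<le> Inf S"
      by (rule cInf_greatest) (use up low in auto)
    ultimately show "\<bar>Inf S - c\<bar> \<le> \<mu>"
      by linarith
  qed
  then show ?thesis
    by blast
qed

lemma local_sharp_maximal_le_sharp_maximal:
  assumes f: "\<And>Q c \<alpha>. cube Q \<Longrightarrow> Q \<subseteq> Q0 \<Longrightarrow> {y\<in>Q. \<bar>f y - c\<bar> > \<alpha>} \<in> sets lebesgue"
    and s: "0 < s"
  shows "local_sharp_maximal s Q0 f x \<le> ennreal (1 / s) * sharp_maximal Q0 f x"
  unfolding local_sharp_maximal_def
proof (rule SUP_least)
  fix Q assume "Q \<in> {Q. cube Q \<and> x \<in> Q \<and> Q \<subseteq> Q0}"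
  then have Q: "cube Q" "x \<in> Q" "Q \<subseteq> Q0"
    by auto
  define c where "c = set_average f Q"
  define I where "I = (\<integral>\<^sup>+y\<in>Q. ennreal \<bar>f y - c\<bar> \<partial>lebesgue)"
  define osc where "osc = I / emeasure lebesgue Q"
  define V where "V = measure lebesgue Q"
  have V: "emeasure lebesgue Q = ennreal V" "0 < V"
    using cube_lmeasurable[OF Q(1)] measure_cube_pos[OF Q(1)] by (auto simp: V_def emeasure_eq_measure2)
  have "(INF c::real. INF \<alpha>\<in>{\<alpha>::real. 0 \<le> \<alpha> \<and>
      emeasure lebesgue {y \<in> Q. \<bar>f y - c\<bar> > \<alpha>} < ennreal s * emeasure lebesgue Q}. ennreal \<alpha>)
      \<le> ennreal (1 / s) * osc"
  proof (cases osc)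
    case top
    then show ?thesis
      using s by (simp add: ennreal_mult_top)
  next
    case (real r)
    have I_eq: "I = ennreal (r * V)"
    proof -
      have "I = osc * emeasure lebesgue Q"
        using V by (simp add: osc_def ennreal_divide_times ennreal_divide_self)
      then show ?thesis
        using real V by (simp add: ennreal_mult)
    qed
    show ?thesis
    proof (rule ennreal_le_epsilon)
      fix e :: real assume "0 < e"
      \<comment> \<open>Chebyshev at level \<open>r / s\<close> would only give
        \<open>|B| \<le> s |Q|\<close>; the extra \<open>e\<close> yields the strict inequality in
        the definition of the local oscillation.\<close>
      define \<alpha> where "\<alpha> = r / s + e"
      have \<alpha>: "0 < \<alpha>" "r < s * \<alpha>"
        using real s \<open>0 < e\<close> by (auto simp: \<alpha>_def distrib_left intro: add_nonneg_pos)
      define B where "B = {y \<in> Q. \<bar>f y - c\<bar> > \<alpha>}"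
      have B: "B \<in> lmeasurable"
        unfolding B_def by (rule fmeasurableI2[OF cube_lmeasurable[OF Q(1)] _ f[OF Q(1,3)]]) auto
      have "ennreal \<alpha> * emeasure lebesgue B = (\<integral>\<^sup>+y. ennreal \<alpha> * indicator B y \<partial>lebesgue)"
        using B by (simp add: nn_integral_cmult_indicator)
      also have "\<dots> \<le> I"
        unfolding I_def by (rule nn_integral_mono) (auto simp: B_def ennreal_leI split: split_indicator)
      finally have "\<alpha> * measure lebesgue B \<le> r * V"
        using B \<alpha>(1) real V by (simp add: I_eq emeasure_eq_measure2 flip: ennreal_mult)
      also have "\<dots> < \<alpha> * (s * V)"
        using mult_strict_right_mono[OF \<alpha>(2) V(2)] by (simp add: mult_ac)
      finally have "measure lebesgue B < s * V"
        using \<alpha>(1) by simp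
      then have "emeasure lebesgue B < ennreal s * emeasure lebesgue Q"
        using B V s by (simp add: emeasure_eq_measure2 ennreal_less_iff flip: ennreal_mult)
      then have "(INF c::real. INF \<alpha>\<in>{\<alpha>::real. 0 \<le> \<alpha> \<and>
        emeasure lebesgue {y \<in> Q. \<bar>f y - c\<bar> > \<alpha>} < ennreal s * emeasure lebesgue Q}. ennreal \<alpha>) \<le> ennreal \<alpha>"
        using \<alpha>(1) unfolding B_def by (intro INF_lower2[of c] INF_lower2[of \<alpha>]) auto
      also have "\<dots> = ennreal (1 / s) * osc + ennreal e"
        using real s \<open>0 < e\<close> by (simp add: \<alpha>_def flip: ennreal_mult ennreal_plus)
      finally show "(INF c::real. INF \<alpha>\<in>{\<alpha>::real. 0 \<le> \<alpha> \<and>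
        emeasure lebesgue {y \<in> Q. \<bar>f y - c\<bar> > \<alpha>} < ennreal s * emeasure lebesgue Q}. ennreal \<alpha>)
        \<le> ennreal (1 / s) * osc + ennreal e" .
    qed
  qed
  also have "osc \<le> sharp_maximal Q0 f x"
    unfolding sharp_maximal_def osc_def I_def c_def by (rule SUP_upper) (use Q in simp)
  finally show "(INF c::real. INF \<alpha>\<in>{\<alpha>::real. 0 \<le> \<alpha> \<and>
      emeasure lebesgue {y \<in> Q. \<bar>f y - c\<bar> > \<alpha>} < ennreal s * emeasure lebesgue Q}. ennreal \<alpha>)
      \<le> ennreal (1 / s) * sharp_maximal Q0 f x"
    by (simp add: mult_left_mono)
qed

section \<open>The rearrangement inequality\<close>

lemma space_wmeasure: "space (wmeasure Q0 w) = Q0"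
  by (simp add: wmeasure_def space_restrict_space)

lemma sets_wmeasure: "cube Q0 \<Longrightarrow> A \<in> sets (wmeasure Q0 w) \<longleftrightarrow> A \<in> sets lebesgue \<and> A \<subseteq> Q0"
  using fmeasurableD[OF cube_lmeasurable, of Q0]
  by (auto simp: wmeasure_def sets_restrict_space_iff)

lemma emeasure_wmeasure_finite:
  assumes "weight_on Q0 w"
  shows "emeasure (wmeasure Q0 w) A < \<infinity>"
proof -
  have "w \<in> borel_measurable (lebesgue_on Q0)"
    using assms borel_measurable_integrable unfolding weight_on_def by blast
  then have "emeasure (wmeasure Q0 w) (space (wmeasure Q0 w)) = (\<integral>\<^sup>+x. ennreal (w x) \<partial>lebesgue_on Q0)"
    unfolding wmeasure_def
    by (subst emeasure_density) (auto intro!: nn_integral_cong)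
  also have "\<dots> \<le> (\<integral>\<^sup>+x. ennreal (norm (w x)) \<partial>lebesgue_on Q0)"
    by (intro nn_integral_mono) (simp add: ennreal_leI)
  also have "\<dots> < \<infinity>"
    using assms by (simp add: weight_on_def integrable_iff_bounded)
  finally show ?thesis
    using emeasure_space[of "wmeasure Q0 w" A] by (rule le_less_trans[rotated])
qed

lemma emeasure_wmeasure_negligible:
  assumes "cube Q0" "weight_on Q0 w" "A \<subseteq> Q0" "negligible A"
  shows "emeasure (wmeasure Q0 w) A = 0"
proof -
  have w: "(\<lambda>x. ennreal (w x)) \<in> borel_measurable (lebesgue_on Q0)"
    using assms(2) borel_measurable_integrable measurable_compose[OF _ measurable_ennreal]
    unfolding weight_on_def by blast
  have "A \<in> null_sets (lebesgue_on Q0)"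
    using assms fmeasurableD[OF cube_lmeasurable[OF assms(1)]]
    by (simp add: null_sets_restrict_space negligible_iff_null_sets)
  then have "A \<in> null_sets (wmeasure Q0 w)"
    using absolutely_continuousI_density[OF w] by (auto simp: absolutely_continuous_def wmeasure_def)
  then show ?thesis
    by (rule null_setsD1)
qed

lemma level_set_wmeasure:
  fixes f :: "'a::euclidean_space \<Rightarrow> real"
  assumes "cube Q0" "f \<in> borel_measurable (wmeasure Q0 w)" "cube Q" "Q \<subseteq> Q0"
  shows "{y\<in>Q. \<bar>f y - c\<bar> > \<alpha>} \<in> sets lebesgue" "{y\<in>Q. f y > \<alpha>} \<in> sets lebesgue"
proof -
  have "{y \<in> space (wmeasure Q0 w). \<bar>f y - c\<bar> > \<alpha>} \<in> sets (wmeasure Q0 w)"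
    "{y \<in> space (wmeasure Q0 w). f y > \<alpha>} \<in> sets (wmeasure Q0 w)"
    using assms(2) by measurable
  then have "{y \<in> Q0. \<bar>f y - c\<bar> > \<alpha>} \<in> sets lebesgue" "{y \<in> Q0. f y > \<alpha>} \<in> sets lebesgue"
    by (simp_all add: space_wmeasure sets_wmeasure[OF assms(1)])
  then have "{y \<in> Q0. \<bar>f y - c\<bar> > \<alpha>} \<inter> Q \<in> sets lebesgue" "{y \<in> Q0. f y > \<alpha>} \<inter> Q \<in> sets lebesgue"
    using fmeasurableD[OF cube_lmeasurable[OF assms(3)]] by blast+
  moreover have "{y \<in> Q0. \<bar>f y - c\<bar> > \<alpha>} \<inter> Q = {y\<in>Q. \<bar>f y - c\<bar> > \<alpha>}"
    "{y \<in> Q0. f y > \<alpha>} \<inter> Q = {y\<in>Q. f y > \<alpha>}"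
    using assms(4) by auto
  ultimately show "{y\<in>Q. \<bar>f y - c\<bar> > \<alpha>} \<in> sets lebesgue" "{y\<in>Q. f y > \<alpha>} \<in> sets lebesgue"
    by simp_all
qed

text \<open>Apart from \<open>w\<close> being a weight, this is the only form in which
  \<open>A_infinity\<close> enters the argument.\<close>

lemma A_infinity_halving:
  assumes "cube Q0" "A_infinity Q0 w"
  shows "\<exists>\<rho>>0. \<forall>Q A. cube Q \<longrightarrow> Q \<subseteq> Q0 \<longrightarrow> A \<in> sets lebesgue \<longrightarrow> A \<subseteq> Q \<longrightarrow>
    measure lebesgue A \<le> \<rho> * measure lebesgue Q \<longrightarrow>
    emeasure (wmeasure Q0 w) A \<le> ennreal (1/2) * emeasure (wmeasure Q0 w) Q"
proof -
  have w: "weight_on Q0 w"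
    using assms by (simp add: A_infinity_def)
  obtain C \<delta> where C: "C > 0" "\<delta> > 0" and le: "\<And>Q E. cube Q \<and> Q \<subseteq> Q0 \<and> E \<in> sets lebesgue \<and> E \<subseteq> Q \<Longrightarrow>
      measure (wmeasure Q0 w) E / measure (wmeasure Q0 w) Q
        \<le> C * (measure lebesgue E / measure lebesgue Q) powr \<delta>"
    using assms unfolding A_infinity_def by blast
  \<comment> \<open>The solution of \<open>C * \<rho> powr \<delta> = 1/2\<close>.\<close>
  define \<rho> where "\<rho> = (1 / (2 * C)) powr (1 / \<delta>)"
  have \<rho>: "0 < \<rho>" "C * \<rho> powr \<delta> = 1/2"
    using C by (auto simp: \<rho>_def powr_powr)
  have em: "emeasure (wmeasure Q0 w) B = ennreal (measure (wmeasure Q0 w) B)" for B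
    using emeasure_wmeasure_finite[OF w, of B] by (simp add: emeasure_eq_ennreal_measure less_top)
  have "emeasure (wmeasure Q0 w) A \<le> ennreal (1/2) * emeasure (wmeasure Q0 w) Q"
    if Q: "cube Q" "Q \<subseteq> Q0" "A \<in> sets lebesgue" "A \<subseteq> Q"
      and A: "measure lebesgue A \<le> \<rho> * measure lebesgue Q" for Q A
  proof (cases "measure (wmeasure Q0 w) Q = 0")
    \<comment> \<open>Here the quotient in \<open>A_infinity\<close> is 0 by convention and says
      nothing; monotonicity of the measure is enough.\<close>
    case True
    have "Q \<in> sets (wmeasure Q0 w)"
      using fmeasurableD[OF cube_lmeasurable[OF Q(1)]] Q(2) by (simp add: sets_wmeasure[OF assms(1)])
    then have "emeasure (wmeasure Q0 w) A \<le> emeasure (wmeasure Q0 w) Q"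
      by (rule emeasure_mono[OF Q(4)])
    then show ?thesis
      using True by (simp add: em)
  next
    case False
    then have pos: "0 < measure (wmeasure Q0 w) Q"
      using measure_nonneg[of "wmeasure Q0 w" Q] by linarith
    have "measure lebesgue A / measure lebesgue Q \<le> \<rho>"
      using A measure_cube_pos[OF Q(1)] by (simp add: field_simps)
    then have "C * (measure lebesgue A / measure lebesgue Q) powr \<delta> \<le> C * \<rho> powr \<delta>"
      using C by (intro mult_left_mono powr_mono2) auto
    then have "measure (wmeasure Q0 w) A / measure (wmeasure Q0 w) Q \<le> 1/2"
      using le[of Q A] Q \<rho>(2) by linarith
    then have "measure (wmeasure Q0 w) A \<le> 1/2 * measure (wmeasure Q0 w) Q"
      using pos by (simp add: field_simps)
    then have "ennreal (measure (wmeasure Q0 w) A) \<le> ennreal (1/2 * measure (wmeasure Q0 w) Q)"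
      by (rule ennreal_leI)
    also have "\<dots> = ennreal (1/2) * ennreal (measure (wmeasure Q0 w) Q)"
      by (rule ennreal_mult) simp_all
    finally show ?thesis
      unfolding em .
  qed
  then show ?thesis
    using \<rho>(1) by blast
qed

section \<open>The pointwise bound between rearrangements\<close>

lemma rearrangement_eq_0:
  assumes "emeasure M (space M) = 0"
  shows "rearrangement M g t = 0"
proof -
  have "emeasure M {x \<in> space M. g x > ennreal 0} = 0"
    using emeasure_space[of M] assms by (metis le_zero_eq)
  then have "rearrangement M g t \<le> ennreal 0"
    unfolding rearrangement_def by (intro INF_lower) simp
  then show ?thesis
    by simp
qed

text \<open>\<open>k\<close> is the base 2 logarithm of \<open>2 * W / t\<close>, rounded up and
  replaced by 0 if negative. The number \<open>2 + 2 * k\<close> is the level, in units of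
  \<open>\<mu>\<close>, reached after \<open>k\<close> halvings and the passage to the
  median.\<close>

lemma log_many_halvings:
  fixes W t :: real
  assumes "0 < W" "0 < t" "t < 1"
  shows "\<exists>k. (1/2) ^ k * W \<le> t / 2 \<and> 2 + 2 * real k \<le> (4 + 4 * \<bar>ln (2 * W)\<bar>) * (1 - ln t)"
proof -
  define r where "r = ln (2 * W / t) / ln 2"
  define k where "k = nat \<lceil>r\<rceil>"
  have "r \<le> real k"
    unfolding k_def by linarith
  then have "ln (2 * W / t) \<le> real k * ln 2"
    by (simp add: r_def field_simps)
  also have "\<dots> = ln (2 ^ k)"
    by (simp add: ln_realpow)
  finally have "2 * W / t \<le> 2 ^ k"
    using assms by (simp add: ln_le_cancel_iff)
  then have 1: "(1/2) ^ k * W \<le> t / 2"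
    using assms by (simp add: field_simps power_one_over)
  have "ln (2 * W / t) = ln (2 * W) - ln t"
    using assms by (simp add: ln_div)
  moreover have "ln t < 0"
    using assms by simp
  ultimately have L: "ln (2 * W / t) \<le> \<bar>ln (2 * W)\<bar> - ln t" "0 \<le> \<bar>ln (2 * W)\<bar> - ln t" "ln t < 0"
    by linarith+
  \<comment> \<open>Since \<open>2 * ln 2 \<ge> 1\<close>, division by \<open>ln 2\<close> costs at
    most a factor 2.\<close>
  have "(\<bar>ln (2 * W)\<bar> - ln t) * 1 \<le> (\<bar>ln (2 * W)\<bar> - ln t) * (2 * ln 2)"
    using L(2) ln2_ge_two_thirds by (intro mult_left_mono) auto
  then have "ln (2 * W / t) \<le> (\<bar>ln (2 * W)\<bar> - ln t) * (2 * ln 2)"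
    using L(1) by simp
  then have "ln (2 * W / t) \<le> 2 * (\<bar>ln (2 * W)\<bar> - ln t) * ln 2"
    by (simp only: mult_ac)
  then have "r \<le> 2 * (\<bar>ln (2 * W)\<bar> - ln t)"
    unfolding r_def by (subst pos_divide_le_eq) simp_all
  moreover have "real (nat \<lceil>r\<rceil>) \<le> y + 1" if "r \<le> y" "0 \<le> y" for y
    using that by linarith
  ultimately have "real k \<le> 2 * (\<bar>ln (2 * W)\<bar> - ln t) + 1"
    using L(2) by (simp add: k_def)
  moreover have "0 \<le> \<bar>ln (2 * W)\<bar> * (- ln t)"
    using L by (intro mult_nonneg_nonneg) auto
  ultimately have "2 + 2 * real k \<le> (4 + 4 * \<bar>ln (2 * W)\<bar>) * (1 - ln t)"
    using L by (simp add: algebra_simps)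
  with 1 show ?thesis
    by blast
qed

text \<open>If \<open>w\<close> has positive mass, \<open>c\<close> is a median of \<open>f\<close>,
  the same for all \<open>t\<close>. For fixed \<open>t\<close> the bound is shown for every level
  \<open>\<alpha>\<close> admissible in the rearrangement on the right; the set where the maximal
  function exceeds \<open>\<alpha>\<close> then has measure at most \<open>\<kappa> * t\<close> and
  is the exceptional set of the iteration.\<close>

lemma rearrangement_bound:
  fixes Q0 :: "'a::euclidean_space set"
  assumes Q0: "cube Q0" and A: "A_infinity Q0 w"
  shows "\<exists>s0\<in>{0<..<1}. \<exists>B>0. \<exists>\<kappa>\<in>{0<..1}. \<forall>s\<in>{0<..s0}. \<forall>f\<in>borel_measurable (wmeasure Q0 w). \<exists>c.
    \<forall>t\<in>{0<..<1}. rearrangement (wmeasure Q0 w) (\<lambda>x. ennreal \<bar>f x - c\<bar>) t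
      \<le> ennreal (B * (1 - ln t)) * rearrangement (wmeasure Q0 w) (local_sharp_maximal s Q0 f) (\<kappa> * t)"
proof -
  define \<nu> where "\<nu> = wmeasure Q0 w"
  have w: "weight_on Q0 w"
    using A by (simp add: A_infinity_def)
  have space: "space \<nu> = Q0"
    by (simp add: \<nu>_def space_wmeasure)
  have sets: "X \<in> sets \<nu> \<longleftrightarrow> X \<in> sets lebesgue \<and> X \<subseteq> Q0" for X
    unfolding \<nu>_def by (rule sets_wmeasure[OF Q0])
  define W where "W = measure \<nu> Q0"
  have W: "emeasure \<nu> Q0 = ennreal W" "0 \<le> W"
    using emeasure_wmeasure_finite[OF w, of Q0]
    by (simp_all add: W_def \<nu>_def emeasure_eq_ennreal_measure less_top)
  obtain \<rho> where \<rho>: "\<rho> > 0" and halving: "\<And>Q A. cube Q \<Longrightarrow> Q \<subseteq> Q0 \<Longrightarrow> A \<in> sets lebesgue \<Longrightarrow> A \<subseteq> Q \<Longrightarrow>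
    measure lebesgue A \<le> \<rho> * measure lebesgue Q \<Longrightarrow> emeasure \<nu> A \<le> ennreal (1/2) * emeasure \<nu> Q"
    using A_infinity_halving[OF Q0 A] unfolding \<nu>_def by metis
  \<comment> \<open>The loss \<open>2 ^ DIM('a)\<close> in passing to the parent then leaves density
    at most 1/2 on selected cells.\<close>
  define \<theta> :: real where "\<theta> = 1 / 2 ^ (DIM('a) + 1)"
  \<comment> \<open>\<open>s \<le> \<theta>\<close> permits the stopping at density
    \<open>\<theta>\<close>; \<open>s \<le> \<theta> * \<rho>\<close> makes the selected cells fill
    at most the proportion \<open>\<rho>\<close> of the parent.\<close>
  define s0 where "s0 = min \<theta> (\<theta> * \<rho>)"
  have \<theta>: "0 < \<theta>" "\<theta> * 2 ^ DIM('a) = 1/2" "\<theta> \<le> 1/2"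
    by (simp_all add: \<theta>_def field_simps)
  have s0: "0 < s0" "s0 \<le> \<theta>" "s0 \<le> \<theta> * \<rho>"
    using \<theta> \<rho> by (auto simp: s0_def)
  \<comment> \<open>The bound 1/2 leaves the measure \<open>t / 2\<close> for the set where the
    iteration has to decay. The bound \<open>W\<close> makes \<open>\<kappa> * t\<close> smaller
    than the total mass, so that the exceptional set is not all of \<open>Q0\<close>.\<close>
  define \<kappa> where "\<kappa> = (if W = 0 then 1 else min (1/2) W)"
  have \<kappa>: "0 < \<kappa>" "\<kappa> \<le> 1"
    using W by (auto simp: \<kappa>_def)
  define B where "B = 4 + 4 * \<bar>ln (2 * W)\<bar>"
  have B: "B > 0"
    by (simp add: B_def add_pos_nonneg)
  have "\<exists>c. \<forall>t\<in>{0<..<1}. rearrangement \<nu> (\<lambda>x. ennreal \<bar>f x - c\<bar>) t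
      \<le> ennreal (B * (1 - ln t)) * rearrangement \<nu> (local_sharp_maximal s Q0 f) (\<kappa> * t)"
    if s: "s \<in> {0<..s0}" and f: "f \<in> borel_measurable \<nu>" for s f
  proof (cases "W = 0")
    case True
    then show ?thesis
      using W space by (simp add: rearrangement_eq_0)
  next
    case False
    then have W_pos: "0 < W"
      using W by simp
    note level = level_set_wmeasure[OF Q0 f[unfolded \<nu>_def]]
    have s': "0 < s" "s \<le> \<theta>" "s \<le> \<theta> * \<rho>" "s \<le> 1/2"
      using s s0 \<theta> by auto
    obtain m where m: "\<forall>c \<mu>. measure lebesgue {y\<in>Q0. \<bar>f y - c\<bar> > \<mu>} < 1/2 * measure lebesgue Q0 \<longrightarrow> \<bar>m - c\<bar> \<le> \<mu>"
      using median_near_centers[OF level[OF Q0 order_refl] cube_lmeasurable[OF Q0]] by (elim exE)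
    define g where "g = local_sharp_maximal s Q0 f"
    have bound: "rearrangement \<nu> (\<lambda>x. ennreal \<bar>f x - m\<bar>) t \<le> ennreal (B * (1 - ln t)) * ennreal \<alpha>"
      if t: "0 < t" "t < 1" and \<alpha>: "0 \<le> \<alpha>" "emeasure \<nu> {x \<in> Q0. g x > ennreal \<alpha>} \<le> ennreal (\<kappa> * t)" for t \<alpha>
    proof -
      define E where "E = {x \<in> Q0. g x > ennreal \<alpha>}"
      have E: "E \<in> sets lebesgue"
        unfolding E_def g_def local_sharp_maximal_def by (rule sets_lebesgue_maximal_level)
      have osc: "\<exists>c. measure lebesgue {y\<in>Q. \<bar>f y - c\<bar> > \<mu>} < s * measure lebesgue Q"
        if Q: "cube Q" "Q \<subseteq> Q0" "\<not> Q \<subseteq> E" and \<mu>: "\<alpha> < \<mu>" for Q \<mu>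
      proof -
        obtain x where x: "x \<in> Q" "x \<notin> E"
          using Q(3) by blast
        then have "g x \<le> ennreal \<alpha>"
          using Q(2) by (auto simp: E_def not_less)
        then show ?thesis
          unfolding g_def using s' \<alpha>(1) \<mu>
          by (intro oscillation_of_local_sharp_maximal[OF level(1)[OF Q(1,2)] Q(1) x(1) Q(2)]) auto
      qed
      have "\<kappa> * t < \<kappa> * 1"
        using \<kappa> t by (intro mult_strict_left_mono) auto
      also have "\<kappa> \<le> W" "\<kappa> \<le> 1/2"
        using W_pos by (auto simp: \<kappa>_def)
      ultimately have "\<kappa> * t < W" and \<kappa>t: "\<kappa> * t \<le> t / 2"
        using t by (auto simp: mult_right_mono)
      \<comment> \<open>This makes the oscillation bound available on \<open>Q0\<close> itself,
        where the iteration starts.\<close>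
      have "\<not> Q0 \<subseteq> E"
      proof
        assume "Q0 \<subseteq> E"
        then have "E = Q0"
          by (auto simp: E_def)
        then have "ennreal W \<le> ennreal (\<kappa> * t)"
          using \<alpha>(2) W(1) by (simp add: E_def)
        then show False
          using \<open>\<kappa> * t < W\<close> \<kappa> t by (simp add: ennreal_le_iff)
      qed
      obtain k where k: "(1/2) ^ k * W \<le> t / 2" "2 + 2 * real k \<le> B * (1 - ln t)"
        using log_many_halvings[OF W_pos t] unfolding B_def by blast
      \<comment> \<open>The oscillation bound holds only for thresholds strictly above
        \<open>\<alpha>\<close>; the limit to \<open>\<alpha>\<close> is taken afterwards.\<close>
      have main: "rearrangement \<nu> (\<lambda>x. ennreal \<bar>f x - m\<bar>) t \<le> ennreal (B * (1 - ln t) * \<mu>)"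
        if \<mu>: "\<alpha> < \<mu>" for \<mu>
      proof -
        obtain c where c: "measure lebesgue {y\<in>Q0. \<bar>f y - c\<bar> > \<mu>} < s * measure lebesgue Q0"
          using osc[OF Q0 order_refl \<open>\<not> Q0 \<subseteq> E\<close> \<mu>] by blast
        also have "\<dots> \<le> 1/2 * measure lebesgue Q0"
          using s' by (intro mult_right_mono) auto
        finally have mc: "\<bar>m - c\<bar> \<le> \<mu>"
          using m by blast
        define G where "G = {y\<in>Q0 - E. \<bar>f y - c\<bar> > \<mu> + 2 * \<mu> * real k}"
        have "emeasure \<nu> G \<le> ennreal ((1/2) ^ k) * emeasure \<nu> Q0"
          unfolding G_def
        proof (rule good_lambda_iteration[where \<theta> = \<theta> and s = s and ?Q0.0 = Q0])
          show "emeasure \<nu> X = 0" if "X \<subseteq> Q0" "negligible X" for X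
            unfolding \<nu>_def by (rule emeasure_wmeasure_negligible[OF Q0 w that])
          show "emeasure \<nu> X \<le> ennreal (1/2) * emeasure \<nu> Q"
            if "cube Q" "Q \<subseteq> Q0" "X \<in> sets lebesgue" "X \<subseteq> Q" "\<theta> * measure lebesgue X \<le> s * measure lebesgue Q" for Q X
          proof (rule halving[OF that(1-4)])
            have "\<theta> * measure lebesgue X \<le> \<theta> * \<rho> * measure lebesgue Q"
              using that(5) mult_right_mono[OF s'(3), of "measure lebesgue Q"] by simp
            then show "measure lebesgue X \<le> \<rho> * measure lebesgue Q"
              using \<theta>(1) by (simp add: mult.assoc)
          qed
        qed (use sets \<theta> s' level(1) E osc \<mu> Q0 c in auto)
        also have "\<dots> = ennreal ((1/2) ^ k * W)"
          using W by (simp add: ennreal_mult)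
        also have "\<dots> \<le> ennreal (t / 2)"
          using k(1) by (rule ennreal_leI)
        finally have G: "emeasure \<nu> G \<le> ennreal (t / 2)" .
        have "G = {y\<in>Q0. \<bar>f y - c\<bar> > \<mu> + 2 * \<mu> * real k} - E"
          by (auto simp: G_def)
        then have GE: "G \<in> sets \<nu>" "E \<in> sets \<nu>"
          using level(1)[OF Q0 order_refl] E by (auto simp: sets E_def)
        \<comment> \<open>The level \<open>\<mu> + 2 * \<mu> * k\<close> of the iteration, plus
          \<open>\<mu>\<close> for replacing the center \<open>c\<close> by the median
          \<open>m\<close>.\<close>
        define h where "h = 2 * \<mu> + 2 * \<mu> * real k"
        have h: "0 \<le> h"
          using \<alpha>(1) \<mu> by (simp add: h_def)
        have "{x \<in> Q0. ennreal \<bar>f x - m\<bar> > ennreal (h)} \<subseteq> G \<union> E"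
        proof
          fix x assume x: "x \<in> {x \<in> Q0. ennreal \<bar>f x - m\<bar> > ennreal (h)}"
          then have "\<bar>f x - m\<bar> > h"
            using h by (simp add: ennreal_less_iff)
          then have "\<bar>f x - c\<bar> > \<mu> + 2 * \<mu> * real k"
            using mc unfolding h_def by linarith
          then show "x \<in> G \<union> E"
            using x by (auto simp: G_def)
        qed
        then have "emeasure \<nu> {x \<in> Q0. ennreal \<bar>f x - m\<bar> > ennreal (h)} \<le> emeasure \<nu> (G \<union> E)"
          using GE by (intro emeasure_mono) auto
        also have "\<dots> \<le> emeasure \<nu> G + emeasure \<nu> E"
          by (rule emeasure_subadditive[OF GE])
        also have "\<dots> \<le> ennreal (t / 2) + ennreal (t / 2)"
          using order_trans[OF \<alpha>(2) ennreal_leI[OF \<kappa>t]] by (intro add_mono G) (simp add: E_def)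
        also have "\<dots> = ennreal t"
          using t by (simp flip: ennreal_plus)
        finally have "rearrangement \<nu> (\<lambda>x. ennreal \<bar>f x - m\<bar>) t \<le> ennreal (h)"
          unfolding rearrangement_def space using h by (intro INF_lower) simp
        also have "\<dots> \<le> ennreal (B * (1 - ln t) * \<mu>)"
          using mult_right_mono[OF k(2), of \<mu>] \<alpha>(1) \<mu> by (intro ennreal_leI) (simp add: h_def algebra_simps)
        finally show ?thesis .
      qed
      have L: "0 < B * (1 - ln t)"
        using B t by (intro mult_pos_pos) (auto intro: less_trans[of _ 0])
      show ?thesis
      proof (rule ennreal_le_epsilon)
        \<comment> \<open>The threshold exceeds \<open>\<alpha>\<close> by
          \<open>e / (B * (1 - ln t))\<close>, so that the bound exceeds its target by exactly
          \<open>e\<close>.\<close>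
        fix e :: real assume "0 < e"
        then have "rearrangement \<nu> (\<lambda>x. ennreal \<bar>f x - m\<bar>) t \<le> ennreal (B * (1 - ln t) * (\<alpha> + e / (B * (1 - ln t))))"
          using L by (intro main) simp
        also have "B * (1 - ln t) * (\<alpha> + e / (B * (1 - ln t))) = B * (1 - ln t) * \<alpha> + e"
          using less_imp_neq[OF L] by (simp add: distrib_left del: mult_eq_0_iff)
        finally show "rearrangement \<nu> (\<lambda>x. ennreal \<bar>f x - m\<bar>) t \<le> ennreal (B * (1 - ln t)) * ennreal \<alpha> + ennreal e"
          using L \<alpha>(1) \<open>0 < e\<close> by (simp flip: ennreal_mult ennreal_plus)
      qed
    qed
    have "rearrangement \<nu> (\<lambda>x. ennreal \<bar>f x - m\<bar>) t \<le> ennreal (B * (1 - ln t)) * rearrangement \<nu> g (\<kappa> * t)"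
      if t: "t \<in> {0<..<1}" for t
      unfolding rearrangement_def[of \<nu> g]
    proof (rule ennreal_le_mult_INF)
      have "ln t < 0"
        using t by simp
      then show "0 < B * (1 - ln t)"
        using B by simp
    qed (use bound t space in auto)
    then show ?thesis
      unfolding g_def by blast
  qed
  then have *: "\<forall>s\<in>{0<..s0}. \<forall>f\<in>borel_measurable \<nu>. \<exists>c. \<forall>t\<in>{0<..<1}.
      rearrangement \<nu> (\<lambda>x. ennreal \<bar>f x - c\<bar>) t
      \<le> ennreal (B * (1 - ln t)) * rearrangement \<nu> (local_sharp_maximal s Q0 f) (\<kappa> * t)"
    by blast
  show ?thesis
    unfolding \<nu>_def[symmetric]
    by (rule bexI[where x = s0], rule exI[where x = B], rule conjI[OF B], rule bexI[where x = \<kappa>],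
        rule *, use \<kappa> in simp, use s0 \<theta> in simp)
qed

section \<open>Norm inequalities\<close>

lemma rearrangement_cmult_le:
  assumes "0 < c" and le: "\<And>x. h x \<le> ennreal c * g x"
    and sets: "\<And>\<alpha>. {x \<in> space M. g x > ennreal \<alpha>} \<in> sets M"
  shows "rearrangement M h t \<le> ennreal c * rearrangement M g t"
  unfolding rearrangement_def[of M g]
proof (rule ennreal_le_mult_INF[OF assms(1)])
  fix \<alpha> :: real
  assume \<alpha>: "\<alpha> \<in> {\<alpha>. 0 \<le> \<alpha> \<and> emeasure M {x \<in> space M. g x > ennreal \<alpha>} \<le> ennreal t}"
  have "g x > ennreal \<alpha>" if "h x > ennreal (c * \<alpha>)" for x
  proof (rule ccontr)
    assume "\<not> g x > ennreal \<alpha>"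
    then have "ennreal c * g x \<le> ennreal c * ennreal \<alpha>"
      by (intro mult_left_mono) auto
    also have "\<dots> = ennreal (c * \<alpha>)"
      using \<alpha> assms(1) by (simp add: ennreal_mult)
    finally show False
      using le[of x] that by (meson leD order_trans)
  qed
  then have "emeasure M {x \<in> space M. h x > ennreal (c * \<alpha>)} \<le> emeasure M {x \<in> space M. g x > ennreal \<alpha>}"
    by (intro emeasure_mono sets) auto
  also have "\<dots> \<le> ennreal t"
    using \<alpha> by simp
  finally have "rearrangement M h t \<le> ennreal (c * \<alpha>)"
    unfolding rearrangement_def using \<alpha> assms(1) by (intro INF_lower) simp
  then show "rearrangement M h t \<le> ennreal c * ennreal \<alpha>"
    using \<alpha> assms(1) by (simp add: ennreal_mult)
qed

text \<open>In the inner supremum \<open>1 / (1 - ln u)\<close> cancels the logarithmic factor, and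
  monotonicity replaces \<open>\<kappa> * u\<close> by \<open>\<kappa> * t\<close> for
  \<open>u > t\<close>. In the second norm one power of \<open>1 - ln t\<close> turns the exponent
  \<open>b - 1\<close> into \<open>b\<close>.\<close>

lemma LZ_norms_le_of_rearrangement_le:
  fixes h :: "'a \<Rightarrow> ennreal"
  assumes "0 < q" "b \<le> 0" "0 < B" "0 < \<kappa>" "\<kappa> \<le> 1"
    and le: "\<forall>t\<in>{0<..<1}. rearrangement M h t \<le> ennreal (B * (1 - ln t)) * rearrangement M g (\<kappa> * t)"
  shows "LZ_sup_norm M q b h \<le> ennreal (B * (1 - ln \<kappa>) powr (- b)) * LZ_norm M q b g"
    and "LZ_norm M q (b - 1) h \<le> ennreal (B * (1 - ln \<kappa>) powr (- b)) * LZ_norm M q b g"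
proof -
  have pos: "0 < 1 - ln t" if "t < 1" "0 < t" for t :: real
    using that ln_less_zero[of t] by linarith
  have sup: "(SUP u\<in>{t<..<1}. ennreal (1 / (1 - ln u)) * rearrangement M h u)
      \<le> ennreal B * rearrangement M g (\<kappa> * t)" if t: "0 < t" "t < 1" for t
  proof (rule SUP_least)
    fix u assume u: "u \<in> {t<..<1}"
    then have "0 < u" "u < 1"
      using t by auto
    have "ennreal (1 / (1 - ln u)) * rearrangement M h u
        \<le> ennreal (1 / (1 - ln u)) * (ennreal (B * (1 - ln u)) * rearrangement M g (\<kappa> * u))"
      using bspec[OF le, of u] u t by (intro mult_left_mono) auto
    also have "\<dots> = ennreal B * rearrangement M g (\<kappa> * u)"
      using pos[of u] \<open>0 < u\<close> \<open>u < 1\<close> assms(3)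
      by (simp add: mult.assoc[symmetric] flip: ennreal_mult)
    also have "\<dots> \<le> ennreal B * rearrangement M g (\<kappa> * t)"
      using u assms(4) by (intro mult_left_mono rearrangement_antimono) auto
    finally show "ennreal (1 / (1 - ln u)) * rearrangement M h u \<le> ennreal B * rearrangement M g (\<kappa> * t)" .
  qed
  show "LZ_sup_norm M q b h \<le> ennreal (B * (1 - ln \<kappa>) powr (- b)) * LZ_norm M q b g"
    unfolding LZ_sup_norm_def
  proof (rule LZ_norm_dilation[OF assms(1,4,5,2)])
    fix t :: real assume t: "0 < t" "t < 1"
    have "ennreal ((1 - ln t) powr b) * (SUP u\<in>{t<..<1}. ennreal (1 / (1 - ln u)) * rearrangement M h u)
        \<le> ennreal ((1 - ln t) powr b) * (ennreal B * rearrangement M g (\<kappa> * t))"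
      by (intro mult_left_mono sup t) simp
    also have "\<dots> = ennreal (B * (1 - ln t) powr b) * rearrangement M g (\<kappa> * t)"
      using assms(3) by (simp add: ennreal_mult mult_ac)
    finally show "ennreal ((1 - ln t) powr b) * (SUP u\<in>{t<..<1}. ennreal (1 / (1 - ln u)) * rearrangement M h u)
        \<le> ennreal (B * (1 - ln t) powr b) * rearrangement M g (\<kappa> * t)" .
  qed (use assms in simp)
  show "LZ_norm M q (b - 1) h \<le> ennreal (B * (1 - ln \<kappa>) powr (- b)) * LZ_norm M q b g"
    unfolding LZ_norm_def[of M q "b - 1"]
  proof (rule LZ_norm_dilation[OF assms(1,4,5,2)])
    fix t :: real assume t: "0 < t" "t < 1"
    have "ln t < 0"
      using t by simp
    then have weight: "(1 + \<bar>ln t\<bar>) powr (b - 1) * (B * (1 - ln t)) = B * (1 - ln t) powr b"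
      by (simp add: powr_diff)
    have "ennreal ((1 + \<bar>ln t\<bar>) powr (b - 1)) * rearrangement M h t
        \<le> ennreal ((1 + \<bar>ln t\<bar>) powr (b - 1)) * (ennreal (B * (1 - ln t)) * rearrangement M g (\<kappa> * t))"
      using t by (intro mult_left_mono bspec[OF le]) auto
    also have "\<dots> = ennreal (B * (1 - ln t) powr b) * rearrangement M g (\<kappa> * t)"
      using pos[of t] t assms(3) unfolding mult.assoc[symmetric]
      by (subst ennreal_mult[symmetric]) (simp_all only: weight, simp_all)
    finally show "ennreal ((1 + \<bar>ln t\<bar>) powr (b - 1)) * rearrangement M h t
        \<le> ennreal (B * (1 - ln t) powr b) * rearrangement M g (\<kappa> * t)" .
  qed (use assms in simp)
qed

text \<open>Stated for an abstract operator \<open>T\<close> and class \<open>\<Phi>\<close> so that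
  both maximal functions are instances. The constant depends on \<open>B\<close>,
  \<open>\<kappa>\<close> and the exponent of the logarithm, not on \<open>f\<close>.\<close>

lemma infimum_norms_le:
  fixes T :: "('a \<Rightarrow> real) \<Rightarrow> 'a \<Rightarrow> ennreal"
  assumes "0 < q" "b \<le> 0" "0 < B" "0 < \<kappa>" "\<kappa> \<le> 1"
    and le: "\<And>f. \<Phi> f \<Longrightarrow> \<exists>c. \<forall>t\<in>{0<..<1}. rearrangement M (\<lambda>x. ennreal \<bar>f x - c\<bar>) t
      \<le> ennreal (B * (1 - ln t)) * rearrangement M (T f) (\<kappa> * t)"
  shows "(\<exists>C>0. \<forall>f. \<Phi> f \<longrightarrow>
      (INF c::real. LZ_sup_norm M q b (\<lambda>x. ennreal \<bar>f x - c\<bar>)) \<le> ennreal C * LZ_norm M q b (T f)) \<and>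
    (\<exists>C>0. \<forall>f. \<Phi> f \<longrightarrow>
      (INF c::real. LZ_norm M q (b - 1) (\<lambda>x. ennreal \<bar>f x - c\<bar>)) \<le> ennreal C * LZ_norm M q b (T f)) \<and>
    (\<forall>r>0. \<exists>C>0. \<forall>f. \<Phi> f \<longrightarrow>
      (INF c::real. expL_norm M (r / (r + 1)) (\<lambda>x. ennreal \<bar>f x - c\<bar>)) \<le> ennreal C * expL_norm M r (T f))"
proof -
  have "ln \<kappa> \<le> 0"
    using assms by simp
  then have C: "0 < B * (1 - ln \<kappa>) powr (- b')" for b'
    using assms(3) by (intro mult_pos_pos) simp_all
  \<comment> \<open>Kept general in \<open>q'\<close> and \<open>b'\<close>, since the exponential
    estimate uses other parameters than \<open>q\<close> and \<open>b\<close>.\<close>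
  have main: "(INF c::real. LZ_sup_norm M q' b' (\<lambda>x. ennreal \<bar>f x - c\<bar>))
      \<le> ennreal (B * (1 - ln \<kappa>) powr (- b')) * LZ_norm M q' b' (T f)"
    "(INF c::real. LZ_norm M q' (b' - 1) (\<lambda>x. ennreal \<bar>f x - c\<bar>))
      \<le> ennreal (B * (1 - ln \<kappa>) powr (- b')) * LZ_norm M q' b' (T f)"
    if "\<Phi> f" "0 < q'" "b' \<le> 0" for f q' b'
  proof -
    obtain c where c: "\<forall>t\<in>{0<..<1}. rearrangement M (\<lambda>x. ennreal \<bar>f x - c\<bar>) t
      \<le> ennreal (B * (1 - ln t)) * rearrangement M (T f) (\<kappa> * t)"
      using le[OF \<open>\<Phi> f\<close>] by blast
    note bounds = LZ_norms_le_of_rearrangement_le[OF that(2,3) assms(3-5) c]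
    show "(INF c::real. LZ_sup_norm M q' b' (\<lambda>x. ennreal \<bar>f x - c\<bar>))
      \<le> ennreal (B * (1 - ln \<kappa>) powr (- b')) * LZ_norm M q' b' (T f)"
      by (rule INF_lower2[of c]) (simp_all add: bounds(1))
    show "(INF c::real. LZ_norm M q' (b' - 1) (\<lambda>x. ennreal \<bar>f x - c\<bar>))
      \<le> ennreal (B * (1 - ln \<kappa>) powr (- b')) * LZ_norm M q' b' (T f)"
      by (rule INF_lower2[of c]) (simp_all add: bounds(2))
  qed
  have "\<exists>C>0. \<forall>f. \<Phi> f \<longrightarrow>
      (INF c::real. expL_norm M (r / (r + 1)) (\<lambda>x. ennreal \<bar>f x - c\<bar>)) \<le> ennreal C * expL_norm M r (T f)"
    if "0 < r" for r
  proof -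
    \<comment> \<open>By this identity the exponential estimate is the second one with
      \<open>q' = \<infinity>\<close> and \<open>b' = - 1 / r\<close>.\<close>
    have "- 1 / (r / (r + 1)) = - 1 / r - 1"
      using that by (simp add: field_simps)
    then show ?thesis
      using main(2)[of _ \<infinity> "- 1 / r"] C[of "- 1 / r"] that unfolding expL_norm_def by auto
  qed
  then show ?thesis
    using main[OF _ assms(1,2)] C[of b] by blast
qed

theorem corollary3p1:
  fixes Q0 :: "'a::euclidean_space set" and w :: "'a \<Rightarrow> real" and q :: ennreal and b :: real
  assumes "cube Q0"
    and "0 < q"
    and "b < - enn2real (1 / q)"
    and "A_infinity Q0 w"
  shows "
    (\<exists>C>0. \<forall>f. (\<exists>p>1. in_Lp p (wmeasure Q0 w) f) \<longrightarrow>
            (INF c::real. LZ_sup_norm (wmeasure Q0 w) q b (\<lambda>x. ennreal \<bar>f x - c\<bar>))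
              \<le> ennreal C * LZ_norm (wmeasure Q0 w) q b (sharp_maximal Q0 f)) \<and>
    (\<exists>C>0. \<forall>f. (\<exists>p>1. in_Lp p (wmeasure Q0 w) f) \<longrightarrow>
            (INF c::real. LZ_norm (wmeasure Q0 w) q (b - 1) (\<lambda>x. ennreal \<bar>f x - c\<bar>))
              \<le> ennreal C * LZ_norm (wmeasure Q0 w) q b (sharp_maximal Q0 f)) \<and>
    (\<forall>r>0. \<exists>C>0. \<forall>f. (\<exists>p>1. in_Lp p (wmeasure Q0 w) f) \<longrightarrow>
            (INF c::real. expL_norm (wmeasure Q0 w) (r / (r + 1)) (\<lambda>x. ennreal \<bar>f x - c\<bar>))
              \<le> ennreal C * expL_norm (wmeasure Q0 w) r (sharp_maximal Q0 f)) \<and>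
    (\<exists>s0\<in>{0<..<1}. \<forall>s\<in>{0<..s0}.
      (\<exists>C>0. \<forall>f. (\<exists>p>1. in_Lp p (wmeasure Q0 w) f) \<longrightarrow>
              (INF c::real. LZ_sup_norm (wmeasure Q0 w) q b (\<lambda>x. ennreal \<bar>f x - c\<bar>))
                \<le> ennreal C * LZ_norm (wmeasure Q0 w) q b (local_sharp_maximal s Q0 f)) \<and>
      (\<exists>C>0. \<forall>f. (\<exists>p>1. in_Lp p (wmeasure Q0 w) f) \<longrightarrow>
              (INF c::real. LZ_norm (wmeasure Q0 w) q (b - 1) (\<lambda>x. ennreal \<bar>f x - c\<bar>))
                \<le> ennreal C * LZ_norm (wmeasure Q0 w) q b (local_sharp_maximal s Q0 f)) \<and>
      (\<forall>r>0. \<exists>C>0. \<forall>f. (\<exists>p>1. in_Lp p (wmeasure Q0 w) f) \<longrightarrow>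
              (INF c::real. expL_norm (wmeasure Q0 w) (r / (r + 1)) (\<lambda>x. ennreal \<bar>f x - c\<bar>))
                \<le> ennreal C * expL_norm (wmeasure Q0 w) r (local_sharp_maximal s Q0 f)))"
proof -
  define \<nu> where "\<nu> = wmeasure Q0 w"
  have "0 \<le> enn2real (1 / q)"
    by simp
  then have b: "b \<le> 0"
    using assms(3) by linarith
  obtain s0 B \<kappa> where s0: "0 < s0" "s0 < 1" and B: "0 < B" and \<kappa>: "0 < \<kappa>" "\<kappa> \<le> 1"
    and local: "\<forall>s\<in>{0<..s0}. \<forall>f\<in>borel_measurable \<nu>. \<exists>c.
      \<forall>t\<in>{0<..<1}. rearrangement \<nu> (\<lambda>x. ennreal \<bar>f x - c\<bar>) t
        \<le> ennreal (B * (1 - ln t)) * rearrangement \<nu> (local_sharp_maximal s Q0 f) (\<kappa> * t)"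
    using rearrangement_bound[OF assms(1,4)] unfolding \<nu>_def by auto
  have meas: "f \<in> borel_measurable \<nu>" if "\<exists>p>1. in_Lp p \<nu> f" for f
    using that by (auto simp: in_Lp_def)
  \<comment> \<open>The local bound at the parameter \<open>s0\<close>, combined with the comparison
    of maximal functions, which costs the factor \<open>1 / s0\<close>.\<close>
  have sharp: "\<exists>c. \<forall>t\<in>{0<..<1}. rearrangement \<nu> (\<lambda>x. ennreal \<bar>f x - c\<bar>) t
      \<le> ennreal (B / s0 * (1 - ln t)) * rearrangement \<nu> (sharp_maximal Q0 f) (\<kappa> * t)"
    if f: "f \<in> borel_measurable \<nu>" for f
  proof -
    have sets: "{x \<in> space \<nu>. sharp_maximal Q0 f x > ennreal \<alpha>} \<in> sets \<nu>" for \<alpha>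
      unfolding \<nu>_def space_wmeasure sets_wmeasure[OF assms(1)] sharp_maximal_def
      using sets_lebesgue_maximal_level by blast
    have compare: "rearrangement \<nu> (local_sharp_maximal s0 Q0 f) t
        \<le> ennreal (1 / s0) * rearrangement \<nu> (sharp_maximal Q0 f) t" for t
      using s0(1) level_set_wmeasure(1)[OF assms(1) f[unfolded \<nu>_def]]
      by (intro rearrangement_cmult_le local_sharp_maximal_le_sharp_maximal sets) auto
    obtain c where c: "\<forall>t\<in>{0<..<1}. rearrangement \<nu> (\<lambda>x. ennreal \<bar>f x - c\<bar>) t
        \<le> ennreal (B * (1 - ln t)) * rearrangement \<nu> (local_sharp_maximal s0 Q0 f) (\<kappa> * t)"
      using local f s0(1) by (meson greaterThanAtMost_iff order_refl)
    have "rearrangement \<nu> (\<lambda>x. ennreal \<bar>f x - c\<bar>) t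
      \<le> ennreal (B / s0 * (1 - ln t)) * rearrangement \<nu> (sharp_maximal Q0 f) (\<kappa> * t)"
      if t: "t \<in> {0<..<1}" for t
    proof -
      have "ln t < 0"
        using t by simp
      then have eq: "ennreal (B * (1 - ln t)) * ennreal (1 / s0) = ennreal (B / s0 * (1 - ln t))"
        using B s0(1) by (subst ennreal_mult[symmetric]) (simp_all add: mult_ac)
      have "rearrangement \<nu> (\<lambda>x. ennreal \<bar>f x - c\<bar>) t
          \<le> ennreal (B * (1 - ln t)) * rearrangement \<nu> (local_sharp_maximal s0 Q0 f) (\<kappa> * t)"
        using c t by blast
      also have "\<dots> \<le> ennreal (B * (1 - ln t)) * (ennreal (1 / s0) * rearrangement \<nu> (sharp_maximal Q0 f) (\<kappa> * t))"
        by (intro mult_left_mono compare) simp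
      finally show ?thesis
        unfolding mult.assoc[symmetric] eq .
    qed
    then show ?thesis
      by blast
  qed
  have local_norms: "\<forall>s\<in>{0<..s0}.
      (\<exists>C>0. \<forall>f. (\<exists>p>1. in_Lp p \<nu> f) \<longrightarrow>
        (INF c::real. LZ_sup_norm \<nu> q b (\<lambda>x. ennreal \<bar>f x - c\<bar>))
          \<le> ennreal C * LZ_norm \<nu> q b (local_sharp_maximal s Q0 f)) \<and>
      (\<exists>C>0. \<forall>f. (\<exists>p>1. in_Lp p \<nu> f) \<longrightarrow>
        (INF c::real. LZ_norm \<nu> q (b - 1) (\<lambda>x. ennreal \<bar>f x - c\<bar>))
          \<le> ennreal C * LZ_norm \<nu> q b (local_sharp_maximal s Q0 f)) \<and>
      (\<forall>r>0. \<exists>C>0. \<forall>f. (\<exists>p>1. in_Lp p \<nu> f) \<longrightarrow>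
        (INF c::real. expL_norm \<nu> (r / (r + 1)) (\<lambda>x. ennreal \<bar>f x - c\<bar>))
          \<le> ennreal C * expL_norm \<nu> r (local_sharp_maximal s Q0 f))"
    by (intro ballI infimum_norms_le[OF assms(2) b B \<kappa>]) (use local meas in blast)
  have "0 < B / s0"
    using B s0(1) by simp
  note sharp_norms = infimum_norms_le[OF assms(2) b this \<kappa> sharp[OF meas]]
  show ?thesis
    using sharp_norms local_norms s0 unfolding \<nu>_def[symmetric]
    by (intro conjI bexI[of _ s0]) simp_all
qed

end
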